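(* Let $\mathcal{X}\subseteq\mathbb{R}^n$ be a model given as in (IS) or (ES), let $d=\dim\mathcal{X}$, and let $\Delta(\mathcal{X})=\{x_1-x_2:x_1,x_2\in\mathcal{X}\}\subseteq\mathbb{R}^n$. If $s\ge1+\dim\Delta(\mathcal{X})$, then there is a nonempty Euclidean open set of linear maps $\hat\mu:\mathbb{R}^n\to\mathbb{R}^s$ (in the vector space $\mathbb{R}^{s\times n}$) such that $\mu=\hat\mu|_{\mathcal{X}}$ is everywhere identifiable for every $\hat\mu$ in this set. In particular, this holds if $s\ge2d+1$.
   Context: The model is given in one of two ways. (IS): $\mathcal{X}=\{x\in\mathbb{R}^n: f_1(x)=\dots=f_k(x)=0\}$ for polynomials $f_i\in\mathbb{R}[x_1,\dots,x_n]$; in this case $\mathcal X$ is assumed irreducible (nonempty and not a union of two proper algebraic subvarieties). (ES): $\mathcal{X}=\phi(\mathbb{R}^\ell)$ for a polynomial map $\phi:\mathbb{R}^\ell\to\mathbb{R}^n$ (the Zariski closure is then automatically irreducible). The dimension of $\mathcal{X}$ (respectively of $\Delta(\mathcal X)$) is the dimension, as a real algebraic variety, of its Zariski closure in $\mathbb{R}^n$. The map $\mu$ is identifiable at $x\in\mathcal{X}$ if $\mu^{-1}(\mu(x))=\{x\}$, and everywhere identifiable if this holds for every $x\in\mathcal{X}$. *)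

theory Defs
  imports "HOL-Analysis.Analysis" "HOL-Library.Extended_Nat"
begin

definition algebraic_set :: "(real^'n) set \<Rightarrow> bool" where
  "algebraic_set V \<longleftrightarrow>
     (\<exists>F. (\<forall>f\<in>F. real_polynomial_function f) \<and> V = {x. \<forall>f\<in>F. f x = 0})"

definition irreducible_algebraic_set :: "(real^'n) set \<Rightarrow> bool" where
  "irreducible_algebraic_set V \<longleftrightarrow> algebraic_set V \<and> V \<noteq> {} \<and>
     \<not> (\<exists>A B. algebraic_set A \<and> algebraic_set B \<and> A \<subset> V \<and> B \<subset> V \<and> V = A \<union> B)"

definition zariski_closure :: "(real^'n) set \<Rightarrow> (real^'n) set" where
  "zariski_closure S = algebraic_set hull S"

(* Krull dimension: the supremum of the lengths r of chains Z 0 < ... < Z r of irreducible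
   algebraic subsets. It is taken in enat, where the supremum of an unbounded set of
   lengths is infinity rather than an arbitrary number. *)
definition variety_dim :: "(real^'n) set \<Rightarrow> enat" where
  "variety_dim V = Sup {enat r | r. \<exists>Z :: nat \<Rightarrow> (real^'n) set.
     (\<forall>i\<le>r. irreducible_algebraic_set (Z i) \<and> Z i \<subseteq> V) \<and> (\<forall>i<r. Z i \<subset> Z (Suc i))}"

definition model_dim :: "(real^'n) set \<Rightarrow> enat" where
  "model_dim S = variety_dim (zariski_closure S)"

definition implicit_model :: "(real^'n) set \<Rightarrow> bool" where
  "implicit_model X \<longleftrightarrow>
     (\<exists>(k::nat) f. (\<forall>i<k. real_polynomial_function (f i)) \<and> X = {x. \<forall>i<k. f i x = 0}) \<and>
     irreducible_algebraic_set X"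

definition explicit_model :: "(real^'l \<Rightarrow> real^'n) \<Rightarrow> (real^'n) set \<Rightarrow> bool" where
  "explicit_model \<phi> X \<longleftrightarrow> polynomial_function \<phi> \<and> X = range \<phi>"

definition difference_set :: "(real^'n) set \<Rightarrow> (real^'n) set" where
  "difference_set X = {x1 - x2 | x1 x2. x1 \<in> X \<and> x2 \<in> X}"

definition identifiable_at :: "('a \<Rightarrow> 'b) \<Rightarrow> 'a set \<Rightarrow> 'a \<Rightarrow> bool" where
  "identifiable_at \<mu> X x \<longleftrightarrow> {y \<in> X. \<mu> y = \<mu> x} = {x}"

definition everywhere_identifiable :: "('a \<Rightarrow> 'b) \<Rightarrow> 'a set \<Rightarrow> bool" where
  "everywhere_identifiable \<mu> X \<longleftrightarrow> (\<forall>x\<in>X. identifiable_at \<mu> X x)"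

end

theory Submission
  imports Defs
begin

text \<open>
A matrix M identifies every point of X exactly when its kernel meets \<Delta>(X) only in 0. The
  idea is to find finitely many linear forms whose absolute values together bound the norm on
  \<Delta>(X), up to a constant. Such a bound survives every small change of the forms, so it gives an
  open set of matrices; what matters is that dim \<Delta>(X) + 1 forms are enough.

  The passage from dimension to such a bound goes through growth: how fast the space of
  restrictions to a set S of the polynomials of degree at most m grows with m.

  \<^item> If S has growth O(m^d), then any d + 2 linear coordinates satisfy a nontrivial homogeneous
    relation on S, because there are more monomials in them than dimensions
    (\<open>independent_forms_le_growth\<close>). After a linear change of coordinates a homogeneous relation
    is monic in one form, so that form is bounded on S by the remaining ones. Repeating this leaves
    at most d + 1 forms that bound the norm (\<open>norm_le_of_integral_from\<close>). This is Noether
    normalization with homogeneous relations.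

  \<^item> The growth exponent of an algebraic set Y is at most its dimension
    (\<open>growth_le_variety_dim\<close>). Noether normalization with inhomogeneous relations makes all
    coordinates integral over d algebraically independent ones, whence growth O(m^d), and the point
    is that Y then contains a chain of d + 1 irreducible real algebraic sets. Shrink Y to a minimal
    V on which the d coordinates are still independent; V is irreducible. A point of V at which the
    integral equations of minimal degree have nonvanishing derivatives is regular, and the
    intermediate value theorem shows that the projection of V to the d coordinates contains a
    neighbourhood (\<open>open_projection\<close>). Hence d - 1 coordinates stay independent on a slice
    of V on which the last one is constant, and induction on d builds the chain.

  \<^item> The growth of \<Delta>(X) is at most the square of the growth of X
    (\<open>spanned_by_difference_set\<close>), because a polynomial in x - y is a sum of products of
    polynomials in x and in y. This turns the exponent d into 2d and gives the bound 2d + 1.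

  Minimal sets exist because real polynomial functions form a Noetherian ring
  (\<open>hilbert_basis\<close>).
\<close>

section \<open>Forms in a set of functions\<close>

text \<open>
Polynomials are handled as functions. Homogeneous and inhomogeneous polynomials are the same
  notion with different generators: a polynomial of degree at most m in U is a form of degree m in
  U together with the constant function 1. The degree is an index of the derivation, not an
  invariant of the function; the zero function has every degree.
\<close>

inductive form :: "('x \<Rightarrow> real) set \<Rightarrow> nat \<Rightarrow> ('x \<Rightarrow> real) \<Rightarrow> bool" for U where
  zero: "form U m (\<lambda>_. 0)"
| const: "form U 0 (\<lambda>_. c)"
| gen: "u \<in> U \<Longrightarrow> form U (Suc 0) u"
| add: "form U m f \<Longrightarrow> form U m g \<Longrightarrow> form U m (\<lambda>x. f x + g x)"
| mult: "form U m f \<Longrightarrow> form U k g \<Longrightarrow> form U (m + k) (\<lambda>x. f x * g x)"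

lemma form_cmult: "form U m f \<Longrightarrow> form U m (\<lambda>x. c * f x)"
  using form.mult[OF form.const, of U m f c] by simp

lemma form_uminus: "form U m f \<Longrightarrow> form U m (\<lambda>x. - f x)"
  using form_cmult[of U m f "-1"] by simp

lemma form_diff: "form U m f \<Longrightarrow> form U m g \<Longrightarrow> form U m (\<lambda>x. f x - g x)"
  using form.add[OF _ form_uminus, of U m f g] by simp

lemma form_sum: "(\<And>i. i \<in> A \<Longrightarrow> form U m (f i)) \<Longrightarrow> form U m (\<lambda>x. \<Sum>i\<in>A. f i x)"
  by (induction A rule: infinite_finite_induct) (auto intro: form.zero form.add)

lemma form_power: "form U m f \<Longrightarrow> form U (m * i) (\<lambda>x. f x ^ i)"
proof (induction i)
  case 0
  show ?case using form.const[of U 1] by simp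
next
  case (Suc i)
  show ?case using form.mult[OF Suc.prems Suc.IH[OF Suc.prems]] by simp
qed

lemma form_gen_power: "u \<in> U \<Longrightarrow> form U i (\<lambda>x. u x ^ i)"
  using form_power[OF form.gen, of u U i] by simp

lemma form_prod: "(\<And>i. i \<in> A \<Longrightarrow> form U (m i) (f i)) \<Longrightarrow> form U (\<Sum>i\<in>A. m i) (\<lambda>x. \<Prod>i\<in>A. f i x)"
  by (induction A rule: infinite_finite_induct) (auto intro: form.const form.mult)

lemma form_cong_deg: "form U m f \<Longrightarrow> m = k \<Longrightarrow> form U k f"
  by simp

lemma form_subst:
  assumes "form U m f" and "\<And>u. u \<in> U \<Longrightarrow> form U' (Suc 0) u"
  shows "form U' m f"
  using assms(1) by induction (auto intro: form.intros assms(2))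

lemma form_mono: "form U m f \<Longrightarrow> U \<subseteq> U' \<Longrightarrow> form U' m f"
  by (erule form_subst) (auto intro: form.gen)

lemma form_raise:
  assumes "form U m f" "(\<lambda>_. 1) \<in> U" "m \<le> k"
  shows "form U k f"
proof -
  have "form U (m + (k - m)) (\<lambda>x. f x * 1 ^ (k - m))"
    by (rule form.mult[OF assms(1) form_gen_power[OF assms(2)]])
  then show ?thesis using assms(3) by simp
qed

lemma form_cong_point:
  assumes "form U m f" and "\<And>u. u \<in> U \<Longrightarrow> u x = u y"
  shows "f x = f y"
  using assms(1) by induction (auto simp: assms(2))

lemma form_at_zero:
  assumes "form U m f" and "0 < m" and "\<And>u. u \<in> U \<Longrightarrow> u z = 0"
  shows "f z = 0"
  using assms(1,2) by induction (auto simp: assms(3))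

lemma form_scale:
  assumes "form U m f" and "\<And>u. u \<in> U \<Longrightarrow> u y = t * u x"
  shows "f y = t ^ m * f x"
  using assms(1) by induction (auto simp: assms(2) algebra_simps power_add)

text \<open>
The constant is uniform in the point x and in s, so a bound s that varies with x is allowed.
\<close>

lemma form_bound:
  assumes "form U m f"
  shows "\<exists>C\<ge>0. \<forall>x s. 0 \<le> s \<longrightarrow> (\<forall>u\<in>U. \<bar>u x\<bar> \<le> s) \<longrightarrow> \<bar>f x\<bar> \<le> C * s ^ m"
  using assms
proof induction
  case (zero m)
  show ?case by (rule exI[of _ 0]) auto
next
  case (const c)
  show ?case by (rule exI[of _ "\<bar>c\<bar>"]) auto
next
  case (gen u)
  then show ?case by (intro exI[of _ 1]) auto
next
  case (add m f g)
  then obtain C D where C: "C \<ge> 0" "\<And>x s. 0 \<le> s \<Longrightarrow> (\<forall>u\<in>U. \<bar>u x\<bar> \<le> s) \<Longrightarrow> \<bar>f x\<bar> \<le> C * s ^ m"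
    and D: "D \<ge> 0" "\<And>x s. 0 \<le> s \<Longrightarrow> (\<forall>u\<in>U. \<bar>u x\<bar> \<le> s) \<Longrightarrow> \<bar>g x\<bar> \<le> D * s ^ m"
    by blast
  show ?case
  proof (intro exI[of _ "C + D"] conjI allI impI)
    fix x s assume "0 \<le> (s::real)" "\<forall>u\<in>U. \<bar>u x\<bar> \<le> s"
    then show "\<bar>f x + g x\<bar> \<le> (C + D) * s ^ m"
      using C(2)[of s x] D(2)[of s x] by (auto simp: algebra_simps intro: order_trans[OF abs_triangle_ineq])
  qed (use C D in auto)
next
  case (mult m f k g)
  then obtain C D where C: "C \<ge> 0" "\<And>x s. 0 \<le> s \<Longrightarrow> (\<forall>u\<in>U. \<bar>u x\<bar> \<le> s) \<Longrightarrow> \<bar>f x\<bar> \<le> C * s ^ m"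
    and D: "D \<ge> 0" "\<And>x s. 0 \<le> s \<Longrightarrow> (\<forall>u\<in>U. \<bar>u x\<bar> \<le> s) \<Longrightarrow> \<bar>g x\<bar> \<le> D * s ^ k"
    by blast
  show ?case
  proof (intro exI[of _ "C * D"] conjI allI impI)
    fix x s assume s: "0 \<le> (s::real)" "\<forall>u\<in>U. \<bar>u x\<bar> \<le> s"
    have "\<bar>f x\<bar> * \<bar>g x\<bar> \<le> (C * s ^ m) * (D * s ^ k)"
      by (rule mult_mono[OF C(2)[OF s] D(2)[OF s]]) (use C s in auto)
    then show "\<bar>f x * g x\<bar> \<le> C * D * s ^ (m + k)"
      by (simp add: abs_mult power_add mult_ac)
  qed (use C D in auto)
qed

text \<open>
Collecting powers of one generator. With u the constant function 1 this is the decomposition of a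
  polynomial into homogeneous parts.
\<close>

lemma form_expand_insert:
  assumes "form (insert u U) m f"
  shows "\<exists>c. (\<forall>i\<le>m. form U (m - i) (c i)) \<and> f = (\<lambda>x. \<Sum>i\<le>m. c i x * u x ^ i)"
proof -
  define P where "P m f \<longleftrightarrow> (\<exists>c. (\<forall>i\<le>m. form U (m - i) (c i)) \<and> f = (\<lambda>x. \<Sum>i\<le>m. c i x * u x ^ i))"
    for m f
  have single: "P m (\<lambda>x. g x * u x ^ i)" if "form U l g" "l + i = m" for g i l m
    unfolding P_def
  proof (intro exI[of _ "\<lambda>j. if j = i then g else (\<lambda>_. 0)"] conjI)
    show "\<forall>j\<le>m. form U (m - j) (if j = i then g else (\<lambda>_. 0))"
      using that by (auto intro: form.zero)
    have "(\<Sum>j\<le>m. (if j = i then g else (\<lambda>_. 0)) x * u x ^ j) = (\<Sum>j\<in>{i}. g x * u x ^ j)" for x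
      by (rule sum.mono_neutral_cong_right) (use that in auto)
    then show "(\<lambda>x. g x * u x ^ i) = (\<lambda>x. \<Sum>j\<le>m. (if j = i then g else (\<lambda>_. 0)) x * u x ^ j)"
      by simp
  qed
  have add: "P m (\<lambda>x. f x + g x)" if "P m f" "P m g" for m f g
  proof -
    from that obtain c d where
      c: "\<forall>i\<le>m. form U (m - i) (c i)" "f = (\<lambda>x. \<Sum>i\<le>m. c i x * u x ^ i)" and
      d: "\<forall>i\<le>m. form U (m - i) (d i)" "g = (\<lambda>x. \<Sum>i\<le>m. d i x * u x ^ i)"
      unfolding P_def by blast
    show ?thesis unfolding P_def
      by (intro exI[of _ "\<lambda>i x. c i x + d i x"])
         (use c d in \<open>auto intro: form.add simp: sum.distrib algebra_simps\<close>)
  qed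
  have zero: "P m (\<lambda>_. 0)" for m
    using single[of m "\<lambda>_. 0" 0 m] by (simp add: form.zero)
  have sum: "P m (\<lambda>x. \<Sum>i\<in>A. g i x)" if "finite A" "\<And>i. i \<in> A \<Longrightarrow> P m (g i)"
    for m and A :: "nat set" and g
    using that by (induction A rule: finite_induct) (auto intro: zero add)
  have mult: "P (m + k) (\<lambda>x. f x * g x)" if fg: "P m f" "P k g" for m k f g
  proof -
    from fg obtain c d where
      c: "\<forall>i\<le>m. form U (m - i) (c i)" "f = (\<lambda>x. \<Sum>i\<le>m. c i x * u x ^ i)" and
      d: "\<forall>i\<le>k. form U (k - i) (d i)" "g = (\<lambda>x. \<Sum>i\<le>k. d i x * u x ^ i)"
      unfolding P_def by blast
    have "P (m + k) (\<lambda>x. \<Sum>i\<le>m. \<Sum>j\<le>k. (c i x * d j x) * u x ^ (i + j))"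
    proof (intro sum finite_atMost)
      fix i j assume ij: "i \<in> {..m}" "j \<in> {..k}"
      have "form U ((m - i) + (k - j)) (\<lambda>x. c i x * d j x)"
        using c d ij by (intro form.mult) auto
      then show "P (m + k) (\<lambda>x. c i x * d j x * u x ^ (i + j))"
        by (rule single) (use ij in auto)
    qed
    moreover have "(\<lambda>x. f x * g x) = (\<lambda>x. \<Sum>i\<le>m. \<Sum>j\<le>k. (c i x * d j x) * u x ^ (i + j))"
      unfolding c d by (simp add: sum_product power_add mult_ac)
    ultimately show ?thesis by simp
  qed
  have "P m f" using assms
  proof induction
    case (gen v)
    show ?case
    proof (cases "v = u")
      case True
      then show ?thesis using single[of 0 "\<lambda>_. 1" 1 1] by (simp add: form.const)
    next
      case False
      then have "form U (Suc 0) v" using gen by (auto intro: form.gen)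
      then show ?thesis using single[of 1 v 0 1] by simp
    qed
  next
    case (const c)
    show ?case using single[of 0 "\<lambda>_. c" 0 0] by (simp add: form.const)
  qed (auto intro: zero add mult)
  then show ?thesis unfolding P_def .
qed

lemma form_deg_0_const:
  assumes "form U 0 f" shows "f x = f y"
proof -
  have "m = 0 \<longrightarrow> f x = f y" if "form U m f" for m f
    using that by induction auto
  then show ?thesis using assms by blast
qed

lemma form_const_gen:
  assumes "form {\<lambda>_. a} m f" shows "f x = f y"
  using assms by (rule form_cong_point) auto

section \<open>Noetherian rings of functions\<close>

definition func_ring :: "('x \<Rightarrow> real) set \<Rightarrow> bool" where
  "func_ring A \<longleftrightarrow> (\<forall>c. (\<lambda>_. c) \<in> A) \<and>
     (\<forall>f\<in>A. \<forall>g\<in>A. (\<lambda>x. f x + g x) \<in> A \<and> (\<lambda>x. f x * g x) \<in> A)"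

definition func_ideal :: "('x \<Rightarrow> real) set \<Rightarrow> ('x \<Rightarrow> real) set \<Rightarrow> bool" where
  "func_ideal A J \<longleftrightarrow> J \<subseteq> A \<and> (\<lambda>_. 0) \<in> J \<and> (\<forall>f\<in>J. \<forall>g\<in>J. (\<lambda>x. f x + g x) \<in> J) \<and>
     (\<forall>a\<in>A. \<forall>f\<in>J. (\<lambda>x. a x * f x) \<in> J)"

text \<open>
Finite generation is expressed through the smallest ideal that contains G, which avoids writing
  out linear combinations.
\<close>

definition func_noetherian :: "('x \<Rightarrow> real) set \<Rightarrow> bool" where
  "func_noetherian A \<longleftrightarrow> (\<forall>J. func_ideal A J \<longrightarrow>
     (\<exists>G. finite G \<and> G \<subseteq> J \<and> (\<forall>J'. func_ideal A J' \<longrightarrow> G \<subseteq> J' \<longrightarrow> J \<subseteq> J')))"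

definition adjoin :: "('x \<Rightarrow> real) set \<Rightarrow> ('x \<Rightarrow> real) \<Rightarrow> ('x \<Rightarrow> real) set" where
  "adjoin A g = {f. \<exists>m a. (\<forall>i. a i \<in> A) \<and> f = (\<lambda>x. \<Sum>i<m. a i x * g x ^ i)}"

text \<open>
For an ideal J of A[g], the coefficients of g^k in those elements of J that have a representation
  of degree at most k in g.
\<close>

definition leading_coeffs :: "('x \<Rightarrow> real) set \<Rightarrow> ('x \<Rightarrow> real) \<Rightarrow> ('x \<Rightarrow> real) set \<Rightarrow> nat \<Rightarrow> ('x \<Rightarrow> real) set" where
  "leading_coeffs A g J k = {a \<in> A. \<exists>b. (\<forall>i. b i \<in> A) \<and> (\<lambda>x. a x * g x ^ k + (\<Sum>i<k. b i x * g x ^ i)) \<in> J}"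

lemma func_noetherianE:
  assumes "func_noetherian A" "func_ideal A J"
  obtains G where "finite G" "G \<subseteq> J" "\<And>J'. func_ideal A J' \<Longrightarrow> G \<subseteq> J' \<Longrightarrow> J \<subseteq> J'"
  using assms unfolding func_noetherian_def by auto

lemma func_ring_const: "func_ring A \<Longrightarrow> (\<lambda>_. c) \<in> A"
  and func_ring_add: "func_ring A \<Longrightarrow> f \<in> A \<Longrightarrow> g \<in> A \<Longrightarrow> (\<lambda>x. f x + g x) \<in> A"
  and func_ring_mult: "func_ring A \<Longrightarrow> f \<in> A \<Longrightarrow> g \<in> A \<Longrightarrow> (\<lambda>x. f x * g x) \<in> A"
  unfolding func_ring_def by auto

lemma func_ideal_sub: "func_ideal A J \<Longrightarrow> f \<in> J \<Longrightarrow> f \<in> A"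
  and func_ideal_zero: "func_ideal A J \<Longrightarrow> (\<lambda>_. 0) \<in> J"
  and func_ideal_add: "func_ideal A J \<Longrightarrow> f \<in> J \<Longrightarrow> g \<in> J \<Longrightarrow> (\<lambda>x. f x + g x) \<in> J"
  and func_ideal_mult: "func_ideal A J \<Longrightarrow> a \<in> A \<Longrightarrow> f \<in> J \<Longrightarrow> (\<lambda>x. a x * f x) \<in> J"
  unfolding func_ideal_def by auto

lemma func_ideal_diff:
  assumes "(\<lambda>_. - 1) \<in> A" "func_ideal A J" "f \<in> J" "g \<in> J"
  shows "(\<lambda>x. f x - g x) \<in> J"
proof -
  have "(\<lambda>x. f x + (- 1) * g x) \<in> J"
    by (intro func_ideal_add[OF assms(2)] func_ideal_mult[OF assms(2)] assms)
  then show ?thesis by simp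
qed

lemma adjoin_base:
  assumes "func_ring A" "a \<in> A" shows "a \<in> adjoin A g"
  unfolding adjoin_def mem_Collect_eq
  by (rule exI[of _ 1], rule exI[of _ "\<lambda>_. a"]) (use assms in auto)

lemma adjoin_gen:
  assumes "func_ring A" shows "g \<in> adjoin A g"
  unfolding adjoin_def mem_Collect_eq
  by (rule exI[of _ 2], rule exI[of _ "\<lambda>i. if i = 1 then (\<lambda>_. 1) else (\<lambda>_. 0)"])
     (use func_ring_const[OF assms] in \<open>auto simp: numeral_2_eq_2\<close>)

lemma lead_coeff_ideal:
  assumes A: "func_ring A" and J: "func_ideal (adjoin A g) J"
  shows "func_ideal A (leading_coeffs A g J k)"
  unfolding func_ideal_def
proof (intro conjI ballI)
  show "leading_coeffs A g J k \<subseteq> A" unfolding leading_coeffs_def by auto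
  show "(\<lambda>_. 0) \<in> leading_coeffs A g J k"
    unfolding leading_coeffs_def
    by (auto intro!: exI[of _ "\<lambda>_ _. 0"] simp: func_ring_const[OF A] func_ideal_zero[OF J])
next
  fix f h assume "f \<in> leading_coeffs A g J k" "h \<in> leading_coeffs A g J k"
  then obtain b c where f: "f \<in> A" "\<And>i. b i \<in> A" "(\<lambda>x. f x * g x ^ k + (\<Sum>i<k. b i x * g x ^ i)) \<in> J"
    and h: "h \<in> A" "\<And>i. c i \<in> A" "(\<lambda>x. h x * g x ^ k + (\<Sum>i<k. c i x * g x ^ i)) \<in> J"
    unfolding leading_coeffs_def by blast
  show "(\<lambda>x. f x + h x) \<in> leading_coeffs A g J k"
    unfolding leading_coeffs_def mem_Collect_eq
    apply (intro conjI func_ring_add[OF A] f h)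
    apply (rule exI[of _ "\<lambda>i x. b i x + c i x"])
    using func_ideal_add[OF J f(3) h(3)] f h func_ring_add[OF A]
    by (auto simp: algebra_simps sum.distrib)
next
  fix a f assume a: "a \<in> A" "f \<in> leading_coeffs A g J k"
  then obtain b where f: "f \<in> A" "\<And>i. b i \<in> A" "(\<lambda>x. f x * g x ^ k + (\<Sum>i<k. b i x * g x ^ i)) \<in> J"
    unfolding leading_coeffs_def by blast
  show "(\<lambda>x. a x * f x) \<in> leading_coeffs A g J k"
    unfolding leading_coeffs_def mem_Collect_eq
    apply (intro conjI func_ring_mult[OF A] f a)
    apply (rule exI[of _ "\<lambda>i x. a x * b i x"])
    using func_ideal_mult[OF J adjoin_base[OF A a(1)] f(3)] f a func_ring_mult[OF A]
    by (auto simp: algebra_simps sum_distrib_left)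
qed

lemma lead_coeff_Suc:
  assumes A: "func_ring A" and J: "func_ideal (adjoin A g) J"
  shows "leading_coeffs A g J k \<subseteq> leading_coeffs A g J (Suc k)"
proof
  fix f assume "f \<in> leading_coeffs A g J k"
  then obtain b where f: "f \<in> A" "\<And>i. b i \<in> A" "(\<lambda>x. f x * g x ^ k + (\<Sum>i<k. b i x * g x ^ i)) \<in> J"
    unfolding leading_coeffs_def by blast
  let ?b = "\<lambda>i. case i of 0 \<Rightarrow> (\<lambda>_. 0) | Suc j \<Rightarrow> b j"
  have "(\<lambda>x. g x * (f x * g x ^ k + (\<Sum>i<k. b i x * g x ^ i))) \<in> J"
    by (rule func_ideal_mult[OF J adjoin_gen[OF A] f(3)])
  moreover have "(\<lambda>x. g x * (f x * g x ^ k + (\<Sum>i<k. b i x * g x ^ i)))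
      = (\<lambda>x. f x * g x ^ Suc k + (\<Sum>i<Suc k. ?b i x * g x ^ i))"
    by (rule ext) (simp add: sum.lessThan_Suc_shift algebra_simps sum_distrib_left del: sum.lessThan_Suc)
  moreover have "?b i \<in> A" for i
    using f func_ring_const[OF A] by (cases i) auto
  ultimately show "f \<in> leading_coeffs A g J (Suc k)"
    unfolding leading_coeffs_def mem_Collect_eq using f(1) by (intro conjI exI[of _ ?b]) auto
qed

text \<open>
Hilbert's argument: the ideals of leading coefficients increase with the degree and stabilize at
  some N. Lifts to J of finite generating sets of the first N + 1 of them generate J, because the
  top term of any element can be removed by a multiple of a lift. The powers of g may be dependent
  over A, so leading coefficients are taken over all representations of an element.
\<close>

theorem hilbert_basis:
  assumes A: "func_ring A" and noeth: "func_noetherian A"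
  shows "func_noetherian (adjoin A g)"
  unfolding func_noetherian_def
proof (intro allI impI)
  fix J assume J: "func_ideal (adjoin A g) J"
  let ?L = "leading_coeffs A g"
  have mono: "?L K k \<subseteq> ?L K l" if "k \<le> l" "func_ideal (adjoin A g) K" for k l K
    using lift_Suc_mono_le[of "?L K", OF lead_coeff_Suc[OF A that(2)] that(1)] .
  have "func_ideal A (\<Union>k. ?L J k)"
    unfolding func_ideal_def
  proof (intro conjI ballI)
    show "(\<Union>k. ?L J k) \<subseteq> A" "(\<lambda>_. 0) \<in> (\<Union>k. ?L J k)"
      using func_ideal_sub[OF lead_coeff_ideal[OF A J]] func_ideal_zero[OF lead_coeff_ideal[OF A J]] by auto
  next
    fix f h assume "f \<in> (\<Union>k. ?L J k)" "h \<in> (\<Union>k. ?L J k)"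
    then obtain k l where "f \<in> ?L J k" "h \<in> ?L J l" by blast
    then have "f \<in> ?L J (max k l)" "h \<in> ?L J (max k l)"
      using mono[OF _ J, of k "max k l"] mono[OF _ J, of l "max k l"] by auto
    then show "(\<lambda>x. f x + h x) \<in> (\<Union>k. ?L J k)"
      using func_ideal_add[OF lead_coeff_ideal[OF A J]] by blast
  next
    fix a f assume "a \<in> A" "f \<in> (\<Union>k. ?L J k)"
    then show "(\<lambda>x. a x * f x) \<in> (\<Union>k. ?L J k)"
      using func_ideal_mult[OF lead_coeff_ideal[OF A J]] by blast
  qed
  then obtain G where G: "finite G" "G \<subseteq> (\<Union>k. ?L J k)"
    "\<And>J'. func_ideal A J' \<Longrightarrow> G \<subseteq> J' \<Longrightarrow> (\<Union>k. ?L J k) \<subseteq> J'"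
    by (rule func_noetherianE[OF noeth]) blast
  have "\<exists>N. G \<subseteq> ?L J N" using G(1,2)
  proof (induction G rule: finite_induct)
    case (insert a G)
    then obtain N k where "G \<subseteq> ?L J N" "a \<in> ?L J k" by auto
    then have "insert a G \<subseteq> ?L J (max k N)"
      using mono[OF _ J, of k "max k N"] mono[OF _ J, of N "max k N"] by auto
    then show ?case by blast
  qed auto
  then obtain N where "G \<subseteq> ?L J N" by blast
  then have stable: "?L J k \<subseteq> ?L J N" for k
    using G(3)[OF lead_coeff_ideal[OF A J]] by blast
  have "\<forall>k. \<exists>G. finite G \<and> G \<subseteq> ?L J k \<and> (\<forall>J'. func_ideal A J' \<longrightarrow> G \<subseteq> J' \<longrightarrow> ?L J k \<subseteq> J')"
    using func_noetherianE[OF noeth lead_coeff_ideal[OF A J]] by metis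
  then obtain H where "\<forall>k. finite (H k) \<and> H k \<subseteq> ?L J k \<and>
      (\<forall>J'. func_ideal A J' \<longrightarrow> H k \<subseteq> J' \<longrightarrow> ?L J k \<subseteq> J')"
    unfolding choice_iff by blast
  then have H: "\<And>k. finite (H k)" "\<And>k. H k \<subseteq> ?L J k"
    "\<And>k J'. func_ideal A J' \<Longrightarrow> H k \<subseteq> J' \<Longrightarrow> ?L J k \<subseteq> J'" by blast+
  have "\<forall>k a. \<exists>b. a \<in> H k \<longrightarrow> (\<forall>i. b i \<in> A) \<and> (\<lambda>x. a x * g x ^ k + (\<Sum>i<k. b i x * g x ^ i)) \<in> J"
    using H(2) unfolding leading_coeffs_def by blast
  then obtain b where "\<forall>k a. a \<in> H k \<longrightarrow> (\<forall>i. b k a i \<in> A) \<and>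
      (\<lambda>x. a x * g x ^ k + (\<Sum>i<k. b k a i x * g x ^ i)) \<in> J"
    unfolding choice_iff by blast
  then have b: "\<And>k a i. a \<in> H k \<Longrightarrow> b k a i \<in> A"
    "\<And>k a. a \<in> H k \<Longrightarrow> (\<lambda>x. a x * g x ^ k + (\<Sum>i<k. b k a i x * g x ^ i)) \<in> J"
    by blast+
  define F where "F = (\<Union>k\<le>N. (\<lambda>a x. a x * g x ^ k + (\<Sum>i<k. b k a i x * g x ^ i)) ` H k)"
  show "\<exists>G. finite G \<and> G \<subseteq> J \<and> (\<forall>J'. func_ideal (adjoin A g) J' \<longrightarrow> G \<subseteq> J' \<longrightarrow> J \<subseteq> J')"
  proof (intro exI[of _ F] conjI allI impI)
    show "finite F" unfolding F_def using H(1) by auto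
    show "F \<subseteq> J" unfolding F_def using b(2) by auto
    fix J' assume J': "func_ideal (adjoin A g) J'" and FJ': "F \<subseteq> J'"
    have JJ: "func_ideal (adjoin A g) (J \<inter> J')"
      using J J' unfolding func_ideal_def by auto
    \<comment> \<open>The ideal \<open>J'\<close> is replaced by its intersection with J, so that subtracting a lift stays inside J.\<close>
    have L_sub: "?L J k \<subseteq> ?L (J \<inter> J') k" if "k \<le> N" for k
    proof (rule H(3)[OF lead_coeff_ideal[OF A JJ]], rule)
      fix a assume a: "a \<in> H k"
      have "(\<lambda>x. a x * g x ^ k + (\<Sum>i<k. b k a i x * g x ^ i)) \<in> J \<inter> J'"
        using b(2)[OF a] FJ' that a unfolding F_def by auto
      moreover have "a \<in> A" using H(2) a unfolding leading_coeffs_def by auto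
      ultimately show "a \<in> ?L (J \<inter> J') k"
        using b(1)[OF a] unfolding leading_coeffs_def mem_Collect_eq by (intro conjI exI[of _ "b k a"]) auto
    qed
    have L_sub': "?L J m \<subseteq> ?L (J \<inter> J') m" for m
    proof (cases "m \<le> N")
      case False
      then show ?thesis using stable[of m] L_sub[of N] mono[OF _ JJ, of N m] by auto
    qed (use L_sub in auto)
    have "f \<in> J'" if "f \<in> J" "\<And>i. a i \<in> A" "f = (\<lambda>x. \<Sum>i<m. a i x * g x ^ i)" for f a m
      using that
    proof (induction m arbitrary: f a)
      case 0
      then show ?case using func_ideal_zero[OF J'] by simp
    next
      case (Suc m)
      have "a m \<in> ?L J m"
        unfolding leading_coeffs_def mem_Collect_eq
        using Suc.prems by (intro conjI exI[of _ a]) (auto simp: add.commute)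
      then obtain c where c: "\<And>i. c i \<in> A"
        "(\<lambda>x. a m x * g x ^ m + (\<Sum>i<m. c i x * g x ^ i)) \<in> J \<inter> J'" (is "?h \<in> _")
        using L_sub'[of m] unfolding leading_coeffs_def by blast
      have "(\<lambda>x. f x - ?h x) \<in> J'"
      proof (rule Suc.IH)
        show "(\<lambda>x. f x - ?h x) \<in> J"
        proof (rule func_ideal_diff[OF _ J])
          show "(\<lambda>_. - 1) \<in> adjoin A g"
            by (rule adjoin_base[OF A func_ring_const[OF A]])
        qed (use Suc.prems c in auto)
        show "(\<lambda>x. a i x + (-1) * c i x) \<in> A" for i
          using Suc.prems c by (intro func_ring_add[OF A] func_ring_mult[OF A] func_ring_const[OF A]) auto
        show "(\<lambda>x. f x - ?h x) = (\<lambda>x. \<Sum>i<m. (a i x + (-1) * c i x) * g x ^ i)"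
          unfolding Suc.prems(3) by (rule ext) (simp add: algebra_simps sum_subtractf)
      qed
      then have "(\<lambda>x. ?h x + (f x - ?h x)) \<in> J'"
        by (rule func_ideal_add[OF J', rotated]) (use c(2) in auto)
      then show ?case by simp
    qed
    then show "J \<subseteq> J'"
      using func_ideal_sub[OF J] unfolding adjoin_def by blast
  qed
qed

section \<open>Real polynomial functions\<close>

definition coord_forms :: "('a::euclidean_space \<Rightarrow> real) set" where
  "coord_forms = (\<lambda>b x. b \<bullet> x) ` Basis"

lemma form_linear:
  fixes v :: "'a::euclidean_space"
  shows "form coord_forms (Suc 0) (\<lambda>x. v \<bullet> x)"
proof -
  have "form coord_forms (Suc 0) (\<lambda>x. \<Sum>b\<in>Basis. (v \<bullet> b) * (b \<bullet> x))"
    by (intro form_sum form_cmult form.gen) (auto simp: coord_forms_def)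
  moreover have "(\<Sum>b\<in>Basis. (v \<bullet> b) * (b \<bullet> x)) = v \<bullet> x" for x
  proof -
    have "v \<bullet> x = (\<Sum>b\<in>Basis. (v \<bullet> b) * (x \<bullet> b))" by (rule euclidean_inner)
    then show ?thesis by (simp only: inner_commute[of x])
  qed
  ultimately show ?thesis by simp
qed

lemma real_polynomial_function_form:
  assumes "form U m f" and "\<And>u. u \<in> U \<Longrightarrow> real_polynomial_function u"
  shows "real_polynomial_function f"
  using assms(1) by induction (auto intro: assms(2))

lemma real_polynomial_function_inner_left: "real_polynomial_function (\<lambda>x. v \<bullet> x)"
  by (rule real_polynomial_function.intros(1)[OF bounded_linear_inner_right])

lemma real_polynomial_function_iff_form:
  fixes f :: "'a::euclidean_space \<Rightarrow> real"
  shows "real_polynomial_function f \<longleftrightarrow> (\<exists>m. form (insert (\<lambda>_. 1) coord_forms) m f)"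
proof
  assume "real_polynomial_function f"
  then show "\<exists>m. form (insert (\<lambda>_. 1) coord_forms) m f"
  proof induction
    case (linear f)
    then have "linear f" by (simp add: bounded_linear.linear)
    then have "f x = adjoint f 1 \<bullet> x" for x
      by (simp add: inner_commute[of "adjoint f 1"] adjoint_works)
    then have f: "f = (\<lambda>x. adjoint f 1 \<bullet> x)" by blast
    have "form (insert (\<lambda>_. 1) coord_forms) (Suc 0) (\<lambda>x. adjoint f 1 \<bullet> x)"
      by (rule form_mono[OF form_linear]) auto
    then show ?case using f by auto
  next
    case (add f g)
    then obtain m k where "form (insert (\<lambda>_. 1) coord_forms) m f" "form (insert (\<lambda>_. 1) coord_forms) k g"
      by blast
    then show ?case
      by (intro exI[of _ "max m k"] form.add) (auto elim!: form_raise)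
  qed (auto intro: form.const form.mult)
next
  assume "\<exists>m. form (insert (\<lambda>_. 1) coord_forms) m f"
  then show "real_polynomial_function f"
    by (auto elim!: real_polynomial_function_form intro: real_polynomial_function_inner_left
        simp: coord_forms_def)
qed

text \<open>
Restriction to lines reduces the two identity principles below to polynomials in one variable.
\<close>

lemma finite_zeros_on_line:
  fixes f :: "'a::euclidean_space \<Rightarrow> real"
  assumes f: "real_polynomial_function f" and nz: "f (x + t0 *\<^sub>R d) \<noteq> 0"
  shows "finite {t. f (x + t *\<^sub>R d) = 0}"
proof -
  have "polynomial_function (\<lambda>t::real. x + t *\<^sub>R d)"
    by (intro polynomial_function_add polynomial_function_const polynomial_function_bounded_linear
        bounded_linear_scaleR_left)
  then have "real_polynomial_function (f \<circ> (\<lambda>t. x + t *\<^sub>R d))"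
    using f by (rule real_polynomial_function_compose)
  then obtain a n where a: "f \<circ> (\<lambda>t. x + t *\<^sub>R d) = (\<lambda>t. \<Sum>i\<le>n::nat. a i * t ^ i)"
    using real_polynomial_function_imp_sum by blast
  then have eq: "f (x + t *\<^sub>R d) = (\<Sum>i\<le>n. a i * t ^ i)" for t
    by (metis comp_apply)
  have "\<exists>i\<le>n. a i \<noteq> 0"
  proof (rule ccontr)
    assume "\<not> (\<exists>i\<le>n. a i \<noteq> 0)"
    then have "f (x + t0 *\<^sub>R d) = 0" unfolding eq by simp
    with nz show False by simp
  qed
  then show ?thesis unfolding eq polyfun_finite_roots .
qed

lemma nonzero_mult_polynomial:
  fixes f g :: "'a::euclidean_space \<Rightarrow> real"
  assumes "real_polynomial_function f" "real_polynomial_function g" "f x \<noteq> 0" "g y \<noteq> 0"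
  shows "\<exists>z. f z * g z \<noteq> 0"
proof -
  have "finite ({t. f (x + t *\<^sub>R (y - x)) = 0} \<union> {t. g (x + t *\<^sub>R (y - x)) = 0})"
    using finite_zeros_on_line[OF assms(1), of x 0 "y - x"] finite_zeros_on_line[OF assms(2), of x 1 "y - x"]
      assms(3,4) by auto
  then obtain t where "t \<notin> {t. f (x + t *\<^sub>R (y - x)) = 0} \<union> {t. g (x + t *\<^sub>R (y - x)) = 0}"
    using ex_new_if_finite[OF infinite_UNIV_char_0] by blast
  then show ?thesis by (intro exI[of _ "x + t *\<^sub>R (y - x)"]) auto
qed

lemma nonzero_polynomial_on_open:
  fixes f :: "'a::euclidean_space \<Rightarrow> real"
  assumes f: "real_polynomial_function f" and "open W" "x \<in> W" "f y \<noteq> 0"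
  shows "\<exists>z\<in>W. f z \<noteq> 0"
proof (rule ccontr)
  assume neg: "\<not> (\<exists>z\<in>W. f z \<noteq> 0)"
  have "open ((\<lambda>t::real. x + t *\<^sub>R (y - x)) -` W)"
    by (rule open_vimage[OF \<open>open W\<close>]) (intro continuous_intros)
  moreover have "(\<lambda>t::real. x + t *\<^sub>R (y - x)) -` W \<subseteq> {t. f (x + t *\<^sub>R (y - x)) = 0}"
    using neg by auto
  moreover have "finite {t. f (x + t *\<^sub>R (y - x)) = 0}"
    using finite_zeros_on_line[OF f, of x 1 "y - x"] assms(4) by auto
  ultimately have "(\<lambda>t::real. x + t *\<^sub>R (y - x)) -` W = {}"
    using finite_imp_not_open finite_subset by blast
  moreover have "0 \<in> (\<lambda>t::real. x + t *\<^sub>R (y - x)) -` W"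
    using \<open>x \<in> W\<close> by simp
  ultimately show False by blast
qed

lemma noetherian_forms:
  fixes W :: "('x \<Rightarrow> real) set"
  assumes "finite W"
  shows "func_noetherian {f. \<exists>m. form (insert (\<lambda>_. 1) W) m f}"
proof -
  define R where "R W = {f. \<exists>m. form (insert (\<lambda>_. 1) W) m f}" for W :: "('x \<Rightarrow> real) set"
  have ring: "func_ring (R W)" for W
  proof -
    have "(\<lambda>x. f x + g x) \<in> R W" if "f \<in> R W" "g \<in> R W" for f g
    proof -
      from that obtain m k where "form (insert (\<lambda>_. 1) W) m f" "form (insert (\<lambda>_. 1) W) k g"
        unfolding R_def by blast
      then have "form (insert (\<lambda>_. 1) W) (max m k) (\<lambda>x. f x + g x)"
        by (intro form.add) (auto elim!: form_raise)
      then show ?thesis unfolding R_def by blast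
    qed
    then show ?thesis
      unfolding func_ring_def by (auto simp: R_def intro: form.const form.mult)
  qed
  have adj: "R (insert u W) = adjoin (R W) u" for u W
  proof
    show "R (insert u W) \<subseteq> adjoin (R W) u"
    proof
      fix f assume "f \<in> R (insert u W)"
      then obtain m where "form (insert u (insert (\<lambda>_. 1) W)) m f"
        unfolding R_def by (auto simp: insert_commute)
      then obtain c where c: "\<forall>i\<le>m. form (insert (\<lambda>_. 1) W) (m - i) (c i)"
        "f = (\<lambda>x. \<Sum>i\<le>m. c i x * u x ^ i)"
        using form_expand_insert by blast
      show "f \<in> adjoin (R W) u"
        unfolding adjoin_def mem_Collect_eq
      proof (rule exI[of _ "Suc m"], rule exI[of _ "\<lambda>i. if i \<le> m then c i else (\<lambda>_. 0)"], intro conjI allI)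
        show "(if i \<le> m then c i else (\<lambda>_. 0)) \<in> R W" for i
          using c(1) func_ring_const[OF ring] unfolding R_def by auto
        show "f = (\<lambda>x. \<Sum>i<Suc m. (if i \<le> m then c i else (\<lambda>_. 0)) x * u x ^ i)"
          unfolding c(2) by (rule ext, rule sum.cong) auto
      qed
    qed
    have R_mono: "R W \<subseteq> R (insert u W)"
      unfolding R_def by (auto elim!: form_mono)
    have u: "u \<in> R (insert u W)"
      unfolding R_def by (auto intro!: exI[of _ "Suc 0"] form.gen)
    have pow: "(\<lambda>x. u x ^ i) \<in> R (insert u W)" for i
      by (induction i) (auto intro: func_ring_const[OF ring] func_ring_mult[OF ring u])
    have "(\<lambda>x. \<Sum>i<m::nat. a i x * u x ^ i) \<in> R (insert u W)" if "\<forall>i. a i \<in> R W" for m a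
    proof (induction m)
      case (Suc m)
      have "a m \<in> R (insert u W)" using that R_mono by blast
      then have "(\<lambda>x. (\<Sum>i<m. a i x * u x ^ i) + a m x * u x ^ m) \<in> R (insert u W)"
        by (intro func_ring_add[OF ring Suc.IH] func_ring_mult[OF ring _ pow])
      then show ?case by simp
    qed (use func_ring_const[OF ring] in simp)
    then show "adjoin (R W) u \<subseteq> R (insert u W)"
      unfolding adjoin_def by auto
  qed
  have "func_noetherian (R W)" using assms
  proof (induction W rule: finite_induct)
    case empty
    show ?case unfolding func_noetherian_def
    proof (intro allI impI)
      fix J assume J: "func_ideal (R {}) J"
      show "\<exists>G. finite G \<and> G \<subseteq> J \<and> (\<forall>J'. func_ideal (R {}) J' \<longrightarrow> G \<subseteq> J' \<longrightarrow> J \<subseteq> J')"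
      proof (cases "\<exists>f\<in>J. \<exists>x. f x \<noteq> 0")
        case True
        then obtain f x where f: "f \<in> J" "f x \<noteq> 0" by blast
        have const: "g y = g x" if "g \<in> R {}" for g y
          using that form_const_gen unfolding R_def by auto
        show ?thesis
        proof (intro exI[of _ "{f}"] conjI allI impI subsetI)
          fix J' g assume J': "func_ideal (R {}) J'" "{f} \<subseteq> J'" "g \<in> J"
          have "(\<lambda>y. (g x / f x) * f y) \<in> J'"
            by (rule func_ideal_mult[OF J'(1) func_ring_const[OF ring]]) (use J' in auto)
          moreover have "(g x / f x) * f y = g y" for y
            using const[of f y] const[of g y] func_ideal_sub[OF J] f J'(3) by auto
          ultimately show "g \<in> J'" by simp
        qed (use f in auto)
      next
        case False
        then have "J \<subseteq> {\<lambda>_. 0}" by auto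
        then show ?thesis
          by (intro exI[of _ "{}"]) (auto dest: func_ideal_zero)
      qed
    qed
  next
    case (insert u W)
    then show ?case unfolding adj by (intro hilbert_basis ring)
  qed
  then show ?thesis unfolding R_def .
qed

lemma noetherian_real_polynomials:
  "func_noetherian {f :: 'a::euclidean_space \<Rightarrow> real. real_polynomial_function f}"
  unfolding real_polynomial_function_iff_form by (rule noetherian_forms) (simp add: coord_forms_def)

section \<open>Algebraic sets\<close>

definition vanishing_ideal :: "(real^'n) set \<Rightarrow> (real^'n \<Rightarrow> real) set" where
  "vanishing_ideal V = {f. real_polynomial_function f \<and> (\<forall>x\<in>V. f x = 0)}"

lemma func_ideal_vanishing: "func_ideal {f. real_polynomial_function f} (vanishing_ideal V)"
  unfolding func_ideal_def vanishing_ideal_def by auto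

lemma algebraic_eq_zeros_vanishing:
  "algebraic_set V \<Longrightarrow> V = {x. \<forall>f\<in>vanishing_ideal V. f x = 0}"
  unfolding algebraic_set_def vanishing_ideal_def by blast

lemma algebraic_Int_zeros:
  assumes "algebraic_set V" "real_polynomial_function f"
  shows "algebraic_set {x \<in> V. f x = 0}"
proof -
  from assms(1) obtain F where "\<forall>f\<in>F. real_polynomial_function f" "V = {x. \<forall>f\<in>F. f x = 0}"
    unfolding algebraic_set_def by blast
  then show ?thesis
    unfolding algebraic_set_def using assms(2) by (intro exI[of _ "insert f F"]) auto
qed

text \<open>
Over the reals finitely many equations merge into one, the sum of the squares.
\<close>

lemma algebraic_single_equation:
  assumes "algebraic_set V"
  shows "\<exists>f. real_polynomial_function f \<and> V = {x. f x = 0}"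
proof -
  obtain G where G: "finite G" "G \<subseteq> vanishing_ideal V"
    "\<And>J'. func_ideal {f. real_polynomial_function f} J' \<Longrightarrow> G \<subseteq> J' \<Longrightarrow> vanishing_ideal V \<subseteq> J'"
    by (rule func_noetherianE[OF noetherian_real_polynomials func_ideal_vanishing[of V]]) blast
  have poly: "real_polynomial_function g" if "g \<in> G" for g
    using G(2) that unfolding vanishing_ideal_def by auto
  have eq: "(\<Sum>g\<in>G. (g x)\<^sup>2) = 0 \<longleftrightarrow> (\<forall>g\<in>G. g x = 0)" for x
    using G(1) by (simp add: sum_nonneg_eq_0_iff)
  have "x \<in> V \<longleftrightarrow> (\<forall>g\<in>G. g x = 0)" for x
  proof
    assume "\<forall>g\<in>G. g x = 0"
    then have "G \<subseteq> vanishing_ideal {x}"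
      using poly unfolding vanishing_ideal_def by auto
    then have "vanishing_ideal V \<subseteq> vanishing_ideal {x}"
      by (rule G(3)[OF func_ideal_vanishing])
    then show "x \<in> V"
      unfolding vanishing_ideal_def[of "{x}"] by (subst algebraic_eq_zeros_vanishing[OF assms]) auto
  qed (use G(2) in \<open>auto simp: vanishing_ideal_def\<close>)
  then have "V = {x. (\<Sum>g\<in>G. (g x)\<^sup>2) = 0}"
    unfolding eq by blast
  moreover have "real_polynomial_function (\<lambda>x. \<Sum>g\<in>G. (g x)\<^sup>2)"
    using G(1) poly by (intro real_polynomial_function_sum real_polynomial_function_power)
  ultimately show ?thesis by (intro exI[of _ "\<lambda>x. \<Sum>g\<in>G. (g x)\<^sup>2"] conjI)
qed

lemma wf_algebraic_subset: "wf {(W, V). algebraic_set W \<and> algebraic_set V \<and> W \<subset> V}"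
  unfolding wf_iff_no_infinite_down_chain
proof
  assume "\<exists>V. \<forall>i. (V (Suc i), V i) \<in> {(W, V). algebraic_set W \<and> algebraic_set V \<and> W \<subset> (V :: (real^'a) set)}"
  then obtain V :: "nat \<Rightarrow> (real^'a) set" where V: "\<And>i. algebraic_set (V i)" "\<And>i. V (Suc i) \<subset> V i" by blast
  have "V j \<subseteq> V i" if "i \<le> j" for i j
    by (rule lift_Suc_antimono_le[of V, OF _ that]) (use V in blast)
  then have mono: "vanishing_ideal (V i) \<subseteq> vanishing_ideal (V j)" if "i \<le> j" for i j
    using that unfolding vanishing_ideal_def by blast
  let ?I = "\<Union>i. vanishing_ideal (V i)"
  have "func_ideal {f. real_polynomial_function f} ?I"
    unfolding func_ideal_def
  proof (intro conjI ballI)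
    fix f g assume "f \<in> ?I" "g \<in> ?I"
    then obtain i j where "f \<in> vanishing_ideal (V i)" "g \<in> vanishing_ideal (V j)" by blast
    then have "f \<in> vanishing_ideal (V (max i j))" "g \<in> vanishing_ideal (V (max i j))"
      using mono[of i "max i j"] mono[of j "max i j"] by auto
    then show "(\<lambda>x. f x + g x) \<in> ?I"
      using func_ideal_add[OF func_ideal_vanishing] by blast
  next
    fix a f assume "a \<in> {f :: real^'a \<Rightarrow> real. real_polynomial_function f}" "f \<in> ?I"
    then show "(\<lambda>x. a x * f x) \<in> ?I"
      using func_ideal_mult[OF func_ideal_vanishing] by blast
  qed (auto simp: vanishing_ideal_def)
  then obtain G where G: "finite G" "G \<subseteq> ?I"
    "\<And>J'. func_ideal {f. real_polynomial_function f} J' \<Longrightarrow> G \<subseteq> J' \<Longrightarrow> ?I \<subseteq> J'"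
    by (rule func_noetherianE[OF noetherian_real_polynomials]) blast
  have "\<exists>N. G \<subseteq> vanishing_ideal (V N)" using G(1,2)
  proof (induction G rule: finite_induct)
    case (insert g G)
    then obtain i j where "G \<subseteq> vanishing_ideal (V i)" "g \<in> vanishing_ideal (V j)" by auto
    then have "insert g G \<subseteq> vanishing_ideal (V (max i j))"
      using mono[of i "max i j"] mono[of j "max i j"] by auto
    then show ?case by blast
  qed auto
  then obtain N where "G \<subseteq> vanishing_ideal (V N)" by blast
  then have "vanishing_ideal (V (Suc N)) \<subseteq> vanishing_ideal (V N)"
    using G(3)[OF func_ideal_vanishing] by blast
  then have "V N \<subseteq> V (Suc N)"
    using algebraic_eq_zeros_vanishing[OF V(1), of N] algebraic_eq_zeros_vanishing[OF V(1), of "Suc N"] by blast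
  then show False using V(2)[of N] by blast
qed

lemma minimal_algebraic_subset:
  assumes "algebraic_set V" "P V"
  shows "\<exists>W. algebraic_set W \<and> W \<subseteq> V \<and> P W \<and> (\<forall>A. algebraic_set A \<longrightarrow> A \<subset> W \<longrightarrow> \<not> P A)"
proof -
  have "V \<in> {W. algebraic_set W \<and> W \<subseteq> V \<and> P W}" using assms by auto
  then obtain W where W: "W \<in> {W. algebraic_set W \<and> W \<subseteq> V \<and> P W}"
    "\<And>A. (A, W) \<in> {(W, V). algebraic_set W \<and> algebraic_set V \<and> W \<subset> V} \<Longrightarrow>
      A \<notin> {W. algebraic_set W \<and> W \<subseteq> V \<and> P W}"
    by (rule wfE_min[OF wf_algebraic_subset]) blast
  have "\<not> P A" if "algebraic_set A" "A \<subset> W" for A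
    using W(1) W(2)[of A] that by blast
  then show ?thesis using W(1) by blast
qed

section \<open>Dual bases and Noether normalization\<close>

text \<open>
A linear coordinate system on the space: the coordinates are the forms given by the inner product
  with w i, and e is the basis of directions in which one coordinate varies. Indices are natural
  numbers so that the number of distinguished coordinates can vary inside a proof.
\<close>

definition dual_bases :: "(nat \<Rightarrow> 'a::euclidean_space) \<Rightarrow> (nat \<Rightarrow> 'a) \<Rightarrow> bool" where
  "dual_bases w e \<longleftrightarrow>
     (\<forall>i<DIM('a). \<forall>j<DIM('a). w i \<bullet> e j = (if i = j then 1 else 0)) \<and>
     (\<forall>x. x = (\<Sum>i<DIM('a). (w i \<bullet> x) *\<^sub>R e i))"

definition first_forms :: "(nat \<Rightarrow> 'a::euclidean_space) \<Rightarrow> nat \<Rightarrow> ('a \<Rightarrow> real) set" where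
  "first_forms w k = (\<lambda>i x. w i \<bullet> x) ` {..<k}"

lemma first_forms_Suc: "first_forms w (Suc k) = insert (\<lambda>x. w k \<bullet> x) (first_forms w k)"
  by (auto simp: first_forms_def lessThan_Suc)

lemma first_formsI: "i < k \<Longrightarrow> (\<lambda>x. w i \<bullet> x) \<in> first_forms w k"
  by (auto simp: first_forms_def)

lemma dual_bases_exist: "\<exists>w e :: nat \<Rightarrow> 'a::euclidean_space. dual_bases w e"
proof -
  obtain b where b: "bij_betw b {..<DIM('a)} (Basis :: 'a set)"
    using ex_bij_betw_nat_finite[of "Basis :: 'a set"] by (auto simp: atLeast0LessThan)
  have mem: "b i \<in> Basis" if "i < DIM('a)" for i
    using b that by (auto simp: bij_betw_def)
  have eq: "b i = b j \<longleftrightarrow> i = j" if "i < DIM('a)" "j < DIM('a)" for i j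
    using b that by (auto simp: bij_betw_def inj_on_def)
  have "(\<Sum>i<DIM('a). (b i \<bullet> x) *\<^sub>R b i) = x" for x
  proof -
    have "(\<Sum>i<DIM('a). (b i \<bullet> x) *\<^sub>R b i) = (\<Sum>c\<in>Basis. (c \<bullet> x) *\<^sub>R c)"
      by (rule sum.reindex_bij_betw[OF b])
    also have "\<dots> = (\<Sum>c\<in>Basis. (x \<bullet> c) *\<^sub>R c)"
      by (simp only: inner_commute[of x])
    also have "\<dots> = x" by (rule euclidean_representation)
    finally show ?thesis .
  qed
  then have "dual_bases b b"
    unfolding dual_bases_def using mem eq by (auto simp: inner_Basis)
  then show ?thesis by blast
qed

lemma dual_bases_inner:
  fixes w e :: "nat \<Rightarrow> 'a::euclidean_space"
  assumes "dual_bases w e" "i < DIM('a)" "j < DIM('a)"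
  shows "w i \<bullet> e j = (if i = j then 1 else 0)"
  using assms unfolding dual_bases_def by auto

lemma dual_bases_representation:
  fixes w e :: "nat \<Rightarrow> 'a::euclidean_space"
  assumes "dual_bases w e"
  shows "(\<Sum>i<DIM('a). (w i \<bullet> x) *\<^sub>R e i) = x"
  using assms unfolding dual_bases_def by metis

lemma dual_bases_coordinates:
  fixes w e :: "nat \<Rightarrow> 'a::euclidean_space"
  assumes "dual_bases w e" "j < DIM('a)" "k \<le> DIM('a)"
  shows "w j \<bullet> (\<Sum>i<k. a i *\<^sub>R e i) = (if j < k then a j else 0)"
proof -
  have "w j \<bullet> (\<Sum>i<k. a i *\<^sub>R e i) = (\<Sum>i<k. if i = j then a i else 0)"
    unfolding inner_sum_right
    by (rule sum.cong) (use dual_bases_inner[OF assms(1,2)] assms(3) in auto)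
  then show ?thesis by (simp add: sum.delta)
qed

lemma form_first_forms_polynomial:
  assumes "form (insert (\<lambda>_. c) (first_forms w k)) m f"
  shows "real_polynomial_function f"
  using assms by (rule real_polynomial_function_form)
    (auto simp: first_forms_def intro: real_polynomial_function_inner_left)

lemma form_dual_bases:
  fixes w e :: "nat \<Rightarrow> 'a::euclidean_space"
  assumes "dual_bases w e" "form (insert c coord_forms) m f"
  shows "form (insert c (first_forms w DIM('a))) m f"
  using assms(2)
proof (rule form_subst)
  fix u assume "u \<in> insert c coord_forms"
  moreover have "form (insert c (first_forms w DIM('a))) (Suc 0) (\<lambda>x. b \<bullet> x)" for b
  proof -
    have "form (insert c (first_forms w DIM('a))) (Suc 0) (\<lambda>x. \<Sum>i<DIM('a). (b \<bullet> e i) * (w i \<bullet> x))"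
      by (intro form_sum form_cmult form.gen insertI2 first_formsI) auto
    moreover have "(\<Sum>i<DIM('a). (b \<bullet> e i) * (w i \<bullet> x)) = b \<bullet> x" for x
    proof -
      have "b \<bullet> x = b \<bullet> (\<Sum>i<DIM('a). (w i \<bullet> x) *\<^sub>R e i)"
        by (simp only: dual_bases_representation[OF assms(1)])
      then show ?thesis by (simp add: inner_sum_right mult.commute)
    qed
    ultimately show ?thesis by simp
  qed
  ultimately show "form (insert c (first_forms w DIM('a))) (Suc 0) u"
    unfolding coord_forms_def by (auto intro: form.gen)
qed

text \<open>
Replacing the basis vector e k by z forces the coordinate forms to be corrected by multiples of
  w k, so that they vanish at z.
\<close>

lemma dual_bases_shear:
  fixes w e :: "nat \<Rightarrow> 'a::euclidean_space"
  assumes dual: "dual_bases w e" and k: "k < DIM('a)" and z: "w k \<bullet> z = 1"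
  shows "dual_bases (\<lambda>i. if i = k then w k else w i - (w i \<bullet> z) *\<^sub>R w k) (e(k := z))"
    (is "dual_bases ?w ?e")
  unfolding dual_bases_def
proof (intro conjI allI impI)
  fix i j assume "i < DIM('a)" "j < DIM('a)"
  then show "?w i \<bullet> ?e j = (if i = j then 1 else 0)"
    using z dual_bases_inner[OF dual] k by (auto simp: inner_diff_left)
next
  fix x
  let ?K = "{..<DIM('a)} - {k}"
  have split: "(\<Sum>i<DIM('a). g i) = g k + sum g ?K" for g :: "nat \<Rightarrow> 'a"
    by (rule sum.remove) (use k in auto)
  have zz: "z = e k + (\<Sum>i\<in>?K. (w i \<bullet> z) *\<^sub>R e i)"
    using dual_bases_representation[OF dual, of z] split[of "\<lambda>i. (w i \<bullet> z) *\<^sub>R e i"] z by simp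
  have "(\<Sum>i<DIM('a). (?w i \<bullet> x) *\<^sub>R ?e i) =
      (w k \<bullet> x) *\<^sub>R z + (\<Sum>i\<in>?K. ((w i \<bullet> x) - (w i \<bullet> z) * (w k \<bullet> x)) *\<^sub>R e i)"
    unfolding split by (auto simp: inner_diff_left intro!: sum.cong)
  also have "(\<Sum>i\<in>?K. ((w i \<bullet> x) - (w i \<bullet> z) * (w k \<bullet> x)) *\<^sub>R e i) =
      (\<Sum>i\<in>?K. (w i \<bullet> x) *\<^sub>R e i) - (w k \<bullet> x) *\<^sub>R (\<Sum>i\<in>?K. (w i \<bullet> z) *\<^sub>R e i)"
    by (simp add: scaleR_diff_left sum_subtractf scaleR_sum_right mult.commute)
  also have "(w k \<bullet> x) *\<^sub>R z + ((\<Sum>i\<in>?K. (w i \<bullet> x) *\<^sub>R e i) - (w k \<bullet> x) *\<^sub>R (\<Sum>i\<in>?K. (w i \<bullet> z) *\<^sub>R e i))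
      = (w k \<bullet> x) *\<^sub>R (z - (\<Sum>i\<in>?K. (w i \<bullet> z) *\<^sub>R e i)) + (\<Sum>i\<in>?K. (w i \<bullet> x) *\<^sub>R e i)"
    by (simp add: scaleR_diff_right)
  also have "z - (\<Sum>i\<in>?K. (w i \<bullet> z) *\<^sub>R e i) = e k"
    using zz by (simp add: algebra_simps)
  also have "(w k \<bullet> x) *\<^sub>R e k + (\<Sum>i\<in>?K. (w i \<bullet> x) *\<^sub>R e i) = x"
    using dual_bases_representation[OF dual, of x] split[of "\<lambda>i. (w i \<bullet> x) *\<^sub>R e i"] by simp
  finally show "x = (\<Sum>i<DIM('a). (?w i \<bullet> x) *\<^sub>R ?e i)" by simp
qed

text \<open>
The coefficient of u^i has degree N - i: the monic equation is compatible with total degree. This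
  is what keeps degrees linear when powers of u are eliminated.
\<close>

definition integral_over :: "('x \<Rightarrow> real) set \<Rightarrow> 'x set \<Rightarrow> ('x \<Rightarrow> real) \<Rightarrow> nat \<Rightarrow> bool" where
  "integral_over U S u N \<longleftrightarrow>
     (\<exists>c. (\<forall>i<N. form U (N - i) (c i)) \<and> (\<forall>x\<in>S. u x ^ N + (\<Sum>i<N. c i x * u x ^ i) = 0))"

lemma integral_over_subst:
  assumes "integral_over U S u N" "\<And>v. v \<in> U \<Longrightarrow> form U' (Suc 0) v" "S' \<subseteq> S"
  shows "integral_over U' S' u N"
  using assms form_subst[OF _ assms(2)] unfolding integral_over_def by blast

lemma regular_direction:
  fixes w e :: "nat \<Rightarrow> 'a::euclidean_space"
  assumes dual: "dual_bases w e" and k: "k < DIM('a)"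
    and h: "form (first_forms w (Suc k)) m h" "h x \<noteq> 0"
  obtains z where "h z \<noteq> 0" "w k \<bullet> z = 1" "\<And>i. k < i \<Longrightarrow> i < DIM('a) \<Longrightarrow> w i \<bullet> z = 0"
proof -
  have "real_polynomial_function h"
    using form_first_forms_polynomial[OF form_mono[OF h(1)]] by blast
  moreover have "w k \<bullet> e k \<noteq> 0"
    using dual_bases_inner[OF dual k k] by simp
  ultimately obtain y where y: "h y \<noteq> 0" "w k \<bullet> y \<noteq> 0"
    using nonzero_mult_polynomial[of h "\<lambda>x. w k \<bullet> x" x "e k"] h(2) real_polynomial_function_inner_left
    by fastforce
  define y' where "y' = (1 / (w k \<bullet> y)) *\<^sub>R y"
  have "h y' = (1 / (w k \<bullet> y)) ^ m * h y"
    by (rule form_scale[OF h(1)]) (auto simp: first_forms_def y'_def)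
  then have y': "h y' \<noteq> 0" "w k \<bullet> y' = 1"
    using y by (auto simp: y'_def)
  define z where "z = (\<Sum>i<Suc k. (w i \<bullet> y') *\<^sub>R e i)"
  have coord: "w i \<bullet> z = (if i < Suc k then w i \<bullet> y' else 0)" if "i < DIM('a)" for i
    unfolding z_def by (rule dual_bases_coordinates[OF dual that]) (use k in auto)
  have "h z = h y'"
    by (rule form_cong_point[OF h(1)]) (use coord k in \<open>auto simp: first_forms_def\<close>)
  then show ?thesis
    by (intro that[of z]) (use y' coord k in auto)
qed

text \<open>
A nonzero form becomes monic, up to a constant factor, in the last coordinate once the
  coordinates are sheared along a direction z with h z \<noteq> 0. The leading coefficient is h z,
  because the other new coordinates vanish at z.
\<close>

lemma noether_reduction:
  fixes w e :: "nat \<Rightarrow> 'a::euclidean_space"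
  assumes dual: "dual_bases w e" and k: "k < DIM('a)"
    and h: "form (first_forms w (Suc k)) m h" "h x \<noteq> 0"
  obtains w' e' a c where "dual_bases w' e'" "\<And>i. k \<le> i \<Longrightarrow> i < DIM('a) \<Longrightarrow> w' i = w i"
    "\<And>j u. k < j \<Longrightarrow> j \<le> DIM('a) \<Longrightarrow> u \<in> first_forms w j \<Longrightarrow> form (first_forms w' j) (Suc 0) u"
    "a \<noteq> 0" "\<And>i. i < m \<Longrightarrow> form (first_forms w' k) (m - i) (c i)"
    "\<And>x. h x = a * (w k \<bullet> x) ^ m + (\<Sum>i<m. c i x * (w k \<bullet> x) ^ i)"
proof -
  obtain z where z: "h z \<noteq> 0" "w k \<bullet> z = 1" "\<And>i. k < i \<Longrightarrow> i < DIM('a) \<Longrightarrow> w i \<bullet> z = 0"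
    using regular_direction[OF assms] by blast
  define w' where "w' = (\<lambda>i. if i = k then w k else w i - (w i \<bullet> z) *\<^sub>R w k)"
  have same: "w' i = w i" if "k \<le> i" "i < DIM('a)" for i
    using z(3)[of i] that by (auto simp: w'_def)
  have sub: "form (first_forms w' j) (Suc 0) u" if j: "k < j" "j \<le> DIM('a)" and u: "u \<in> first_forms w j" for j u
  proof -
    from u obtain i where i: "i < j" "u = (\<lambda>x. w i \<bullet> x)" by (auto simp: first_forms_def)
    show ?thesis
    proof (cases "i = k")
      case True
      then have "u = (\<lambda>x. w' i \<bullet> x)" using i by (simp add: w'_def)
      then show ?thesis using i by (auto intro: form.gen first_formsI)
    next
      case False
      have "form (first_forms w' j) (Suc 0) (\<lambda>x. w' i \<bullet> x + (w i \<bullet> z) * (w' k \<bullet> x))"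
        using i j by (intro form.add form_cmult form.gen first_formsI)
      moreover have "(\<lambda>x. w' i \<bullet> x + (w i \<bullet> z) * (w' k \<bullet> x)) = u"
        using False i by (auto simp: w'_def inner_diff_left)
      ultimately show ?thesis by simp
    qed
  qed
  have "form (first_forms w' (Suc k)) m h"
    by (rule form_subst[OF h(1) sub]) (use k in auto)
  then obtain c where c: "\<forall>i\<le>m. form (first_forms w' k) (m - i) (c i)"
    "h = (\<lambda>x. \<Sum>i\<le>m. c i x * (w' k \<bullet> x) ^ i)"
    unfolding first_forms_Suc using form_expand_insert by blast
  have "c i z = 0" if "i < m" for i
    by (rule form_at_zero[of "first_forms w' k" "m - i"])
       (use c that z in \<open>auto simp: first_forms_def w'_def inner_diff_left\<close>)
  then have "h z = c m z"
    using z(2) by (simp add: c(2) lessThan_Suc_atMost[symmetric] w'_def)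
  moreover have "c m y = c m z" for y
    using c(1) form_deg_0_const[of "first_forms w' k" "c m"] by force
  ultimately have hy: "h y = h z * (w k \<bullet> y) ^ m + (\<Sum>i<m. c i y * (w k \<bullet> y) ^ i)" for y
    by (simp add: c(2) lessThan_Suc_atMost[symmetric] w'_def)
  have dual': "dual_bases w' (e(k := z))"
    unfolding w'_def by (rule dual_bases_shear[OF dual k z(2)])
  show ?thesis
  proof (rule that[OF dual' same sub z(1) _ hy])
    show "form (first_forms w' k) (m - i) (c i)" if "i < m" for i
      using c(1) that by simp
  qed
qed

text \<open>
The integral equations are triangular: the coordinate j is integral over the coordinates below j.
  The parameter \<epsilon> is the value of the additional constant generator. For \<epsilon> = 1 the
  equations are inhomogeneous, for \<epsilon> = 0 they are homogeneous.
\<close>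

definition integral_from :: "real \<Rightarrow> (nat \<Rightarrow> 'a::euclidean_space) \<Rightarrow> nat \<Rightarrow> 'a set \<Rightarrow> bool" where
  "integral_from \<epsilon> w d S \<longleftrightarrow> (\<forall>j. d \<le> j \<longrightarrow> j < DIM('a) \<longrightarrow>
     (\<exists>N. integral_over (insert (\<lambda>_. \<epsilon>) (first_forms w j)) S (\<lambda>x. w j \<bullet> x) N))"

text \<open>
Algebraic independence on S. As the forms are linearly independent on the whole space, a
  polynomial in them is zero as a polynomial exactly if it vanishes everywhere.
\<close>

definition independent_on :: "real \<Rightarrow> (nat \<Rightarrow> 'a::euclidean_space) \<Rightarrow> nat \<Rightarrow> 'a set \<Rightarrow> bool" where
  "independent_on \<epsilon> w d S \<longleftrightarrow> (\<forall>m q. form (insert (\<lambda>_. \<epsilon>) (first_forms w d)) m q \<longrightarrow>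
     (\<forall>x\<in>S. q x = 0) \<longrightarrow> (\<forall>x. q x = 0))"

lemma integral_fromD:
  fixes w :: "nat \<Rightarrow> 'a::euclidean_space"
  assumes "integral_from \<epsilon> w d S" "d \<le> j" "j < DIM('a)"
  shows "\<exists>N. integral_over (insert (\<lambda>_. \<epsilon>) (first_forms w j)) S (\<lambda>x. w j \<bullet> x) N"
  using assms unfolding integral_from_def by simp

lemma independent_onD:
  assumes "independent_on \<epsilon> w d S" "form (insert (\<lambda>_. \<epsilon>) (first_forms w d)) m q" "\<And>x. x \<in> S \<Longrightarrow> q x = 0"
  shows "q x = 0"
  using assms unfolding independent_on_def by simp

lemma integral_from_subset:
  assumes "integral_from \<epsilon> w d S" "S' \<subseteq> S"
  shows "integral_from \<epsilon> w d S'"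
  using assms(1) integral_over_subst[OF _ form.gen assms(2)] unfolding integral_from_def by blast

text \<open>
Take the least d for which all coordinates from d on are integral, over all coordinate systems. A
  relation q between the first d coordinates can be written h + \<epsilon> r with h homogeneous of
  the degree of q and r of smaller degree. If h \<noteq> 0, shearing makes q monic in one more
  coordinate, against the choice of d; if h = 0, the relation r has smaller degree.
\<close>

theorem noether_normalization:
  fixes S :: "'a::euclidean_space set" and \<epsilon> :: real
  assumes "S \<noteq> {}"
  shows "\<exists>(w :: nat \<Rightarrow> 'a) e d. d \<le> DIM('a) \<and> dual_bases w e \<and>
    integral_from \<epsilon> w d S \<and> independent_on \<epsilon> w d S"
proof -
  define P where "P d \<longleftrightarrow> (\<exists>w e :: nat \<Rightarrow> 'a. d \<le> DIM('a) \<and> dual_bases w e \<and> integral_from \<epsilon> w d S)" for d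
  have "P DIM('a)"
    unfolding P_def integral_from_def using dual_bases_exist by auto
  define d where "d = (LEAST d. P d)"
  have "P d" unfolding d_def by (rule LeastI[of P, OF \<open>P DIM('a)\<close>])
  then obtain w e where w: "d \<le> DIM('a)" "dual_bases w e" "integral_from \<epsilon> w d S"
    unfolding P_def by blast
  have indep: "q x = 0" if "form (insert (\<lambda>_. \<epsilon>) (first_forms w d)) m q" "\<forall>x\<in>S. q x = 0" for m q x
    using that
  proof (induction m arbitrary: q x)
    case 0
    then show ?case using assms form_deg_0_const[OF 0(1)] by (metis ex_in_conv)
  next
    case (Suc m)
    obtain c where c: "\<forall>i\<le>Suc m. form (first_forms w d) (Suc m - i) (c i)"
      "q = (\<lambda>x. \<Sum>i\<le>Suc m. c i x * \<epsilon> ^ i)"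
      using form_expand_insert[OF Suc.prems(1)] by auto
    define r where "r = (\<lambda>x. \<Sum>i\<le>m. c (Suc i) x * \<epsilon> ^ i)"
    have r: "form (insert (\<lambda>_. \<epsilon>) (first_forms w d)) m r"
      unfolding r_def
    proof (rule form_sum)
      fix i assume i: "i \<in> {..m}"
      then have "form (first_forms w d) (m - i) (c (Suc i))" using c(1) by auto
      then have "form (insert (\<lambda>_. \<epsilon>) (first_forms w d)) (m - i) (c (Suc i))"
        by (rule form_mono) blast
      then have "form (insert (\<lambda>_. \<epsilon>) (first_forms w d)) ((m - i) + i) (\<lambda>x. c (Suc i) x * \<epsilon> ^ i)"
        using form_gen_power[of "\<lambda>_. \<epsilon>" "insert (\<lambda>_. \<epsilon>) (first_forms w d)" i] by (intro form.mult) auto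
      then show "form (insert (\<lambda>_. \<epsilon>) (first_forms w d)) m (\<lambda>x. c (Suc i) x * \<epsilon> ^ i)"
        using i by simp
    qed
    have q: "q x = c 0 x + \<epsilon> * r x" for x
      unfolding c(2) r_def sum.atMost_Suc_shift by (simp add: sum_distrib_left algebra_simps)
    show ?case
    proof (cases "\<exists>y. c 0 y \<noteq> 0")
      case False
      show ?thesis
      proof (cases "\<epsilon> = 0")
        case False
        then have "\<forall>x\<in>S. r x = 0" using q Suc.prems(2) \<open>\<not> (\<exists>y. c 0 y \<noteq> 0)\<close> by force
        then show ?thesis using q Suc.IH[OF r] \<open>\<not> (\<exists>y. c 0 y \<noteq> 0)\<close> by simp
      qed (use q False in auto)
    next
      case True
      then obtain y where y: "c 0 y \<noteq> 0" by blast
      have c0: "form (first_forms w d) (Suc m) (c 0)" using c(1) by auto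
      have "d \<noteq> 0"
      proof
        assume "d = 0"
        then have "c 0 y = 0"
          by (intro form_at_zero[OF c0]) (auto simp: first_forms_def)
        with y show False by simp
      qed
      then obtain k where k: "d = Suc k" by (cases d) auto
      then have kn: "k < DIM('a)" using w(1) by simp
      obtain w' e' a b where w': "dual_bases w' e'" "\<And>i. k \<le> i \<Longrightarrow> i < DIM('a) \<Longrightarrow> w' i = w i"
        "\<And>j u. k < j \<Longrightarrow> j \<le> DIM('a) \<Longrightarrow> u \<in> first_forms w j \<Longrightarrow> form (first_forms w' j) (Suc 0) u"
        "a \<noteq> 0" "\<And>i. i < Suc m \<Longrightarrow> form (first_forms w' k) (Suc m - i) (b i)"
        "\<And>x. c 0 x = a * (w k \<bullet> x) ^ Suc m + (\<Sum>i<Suc m. b i x * (w k \<bullet> x) ^ i)"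
        using noether_reduction[OF w(2) kn c0[unfolded k] y] by blast
      have subst: "form (insert (\<lambda>_. \<epsilon>) (first_forms w' j)) (Suc 0) u"
        if "k < j" "j \<le> DIM('a)" "u \<in> insert (\<lambda>_. \<epsilon>) (first_forms w j)" for j u
        using that(3)
      proof
        assume "u \<in> first_forms w j"
        then show ?thesis by (rule form_mono[OF w'(3)[OF that(1,2)]]) auto
      qed (auto intro: form.gen)
      have "form (insert (\<lambda>_. \<epsilon>) (first_forms w' (Suc k))) m r"
        by (rule form_subst[OF r subst]) (use k kn in auto)
      then obtain s where s: "\<forall>i\<le>m. form (insert (\<lambda>_. \<epsilon>) (first_forms w' k)) (m - i) (s i)"
        "r = (\<lambda>x. \<Sum>i\<le>m. s i x * (w' k \<bullet> x) ^ i)"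
        unfolding first_forms_Suc insert_commute[of "\<lambda>_. \<epsilon>"] using form_expand_insert by blast
      have "integral_over (insert (\<lambda>_. \<epsilon>) (first_forms w' k)) S (\<lambda>x. w' k \<bullet> x) (Suc m)"
        unfolding integral_over_def
      proof (intro exI[of _ "\<lambda>i x. (1 / a) * (b i x + \<epsilon> * s i x)"] conjI allI impI ballI)
        fix i assume i: "i < Suc m"
        have "form (insert (\<lambda>_. \<epsilon>) (first_forms w' k)) (Suc 0 + (m - i)) (\<lambda>x. \<epsilon> * s i x)"
          using s(1) i by (intro form.mult form.gen) auto
        moreover have "Suc 0 + (m - i) = Suc m - i" using i by simp
        ultimately have es: "form (insert (\<lambda>_. \<epsilon>) (first_forms w' k)) (Suc m - i) (\<lambda>x. \<epsilon> * s i x)"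
          by (rule form_cong_deg)
        have "form (insert (\<lambda>_. \<epsilon>) (first_forms w' k)) (Suc m - i) (b i)"
          by (rule form_mono[OF w'(5)[OF i]]) auto
        from form_cmult[OF form.add[OF this es]] show "form (insert (\<lambda>_. \<epsilon>) (first_forms w' k)) (Suc m - i) (\<lambda>x. (1 / a) * (b i x + \<epsilon> * s i x))" .
      next
        fix x assume x: "x \<in> S"
        let ?u = "w' k \<bullet> x"
        have u: "w k \<bullet> x = ?u" using w'(2)[of k] kn by simp
        have "0 = q x" using Suc.prems(2) x by simp
        also have "q x = a * ?u ^ Suc m + (\<Sum>i<Suc m. b i x * ?u ^ i) + \<epsilon> * (\<Sum>i<Suc m. s i x * ?u ^ i)"
          unfolding q w'(6) s(2) u by (simp add: lessThan_Suc_atMost)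
        also have "\<dots> = a * (?u ^ Suc m + (\<Sum>i<Suc m. (1 / a) * (b i x + \<epsilon> * s i x) * ?u ^ i))"
          using w'(4) by (simp add: distrib_left sum_distrib_left sum.distrib algebra_simps del: sum.lessThan_Suc power_Suc)
        finally show "?u ^ Suc m + (\<Sum>i<Suc m. (1 / a) * (b i x + \<epsilon> * s i x) * ?u ^ i) = 0"
          using w'(4) by simp
      qed
      moreover have "\<exists>N. integral_over (insert (\<lambda>_. \<epsilon>) (first_forms w' j)) S (\<lambda>x. w' j \<bullet> x) N"
        if j: "k < j" "j < DIM('a)" for j
      proof -
        obtain N where "integral_over (insert (\<lambda>_. \<epsilon>) (first_forms w j)) S (\<lambda>x. w j \<bullet> x) N"
          using integral_fromD[OF w(3), of j] j k by auto
        then have "integral_over (insert (\<lambda>_. \<epsilon>) (first_forms w' j)) S (\<lambda>x. w j \<bullet> x) N"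
          by (rule integral_over_subst[OF _ subst]) (use j in auto)
        then show ?thesis using w'(2)[of j] j by auto
      qed
      ultimately have "\<exists>N. integral_over (insert (\<lambda>_. \<epsilon>) (first_forms w' j)) S (\<lambda>x. w' j \<bullet> x) N"
        if "k \<le> j" "j < DIM('a)" for j
        using that by (cases "j = k") auto
      then have "integral_from \<epsilon> w' k S"
        unfolding integral_from_def by blast
      then have "P k"
        unfolding P_def using w'(1) kn by (intro exI[of _ w'] exI[of _ e']) auto
      then have "d \<le> k" unfolding d_def by (rule Least_le)
      then show ?thesis using k by simp
    qed
  qed
  then have "independent_on \<epsilon> w d S"
    unfolding independent_on_def by blast
  then show ?thesis using w by blast
qed

section \<open>Growth of function spaces\<close>

text \<open>
The restrictions of P to S lie in a space of dimension at most K.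
\<close>

definition spanned_by :: "'x set \<Rightarrow> nat \<Rightarrow> ('x \<Rightarrow> real) set \<Rightarrow> bool" where
  "spanned_by S K P \<longleftrightarrow>
     (\<exists>B :: nat \<Rightarrow> 'x \<Rightarrow> real. \<forall>f\<in>P. \<exists>c. \<forall>x\<in>S. f x = (\<Sum>i<K. c i * B i x))"

lemma spanned_by_mono:
  assumes "spanned_by S K P" "K \<le> K'" "P' \<subseteq> P" "S' \<subseteq> S"
  shows "spanned_by S' K' P'"
proof -
  from assms(1) obtain B where B: "\<And>f. f \<in> P \<Longrightarrow> \<exists>c. \<forall>x\<in>S. f x = (\<Sum>i<K. c i * B i x)"
    unfolding spanned_by_def by blast
  show ?thesis unfolding spanned_by_def
  proof (rule exI[of _ B], rule ballI)
    fix f assume "f \<in> P'"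
    then obtain c where c: "\<forall>x\<in>S. f x = (\<Sum>i<K. c i * B i x)" using B assms(3) by blast
    have "(\<Sum>i<K'. (if i < K then c i else 0) * B i x) = (\<Sum>i<K. c i * B i x)" for x
      by (rule sum.mono_neutral_cong_right) (use assms(2) in auto)
    then show "\<exists>c. \<forall>x\<in>S'. f x = (\<Sum>i<K'. c i * B i x)"
      using c assms(4) by (intro exI[of _ "\<lambda>i. if i < K then c i else 0"]) auto
  qed
qed

lemma sum_div_mod:
  fixes F :: "nat \<Rightarrow> nat \<Rightarrow> real"
  shows "(\<Sum>l<N * K. F (l div K) (l mod K)) = (\<Sum>i<N. \<Sum>j<K. F i j)"
proof -
  have "(\<Sum>l\<in>{i * K..<i * K + K}. F (l div K) (l mod K)) = (\<Sum>j<K. F i j)" for i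
  proof -
    have "(\<Sum>l\<in>{0 + i * K..<K + i * K}. F (l div K) (l mod K)) = (\<Sum>j\<in>{0..<K}. F ((j + i * K) div K) ((j + i * K) mod K))"
      by (rule sum.shift_bounds_nat_ivl)
    also have "\<dots> = (\<Sum>j\<in>{0..<K}. F i j)"
      by (rule sum.cong) auto
    finally show ?thesis by (simp add: add.commute atLeast0LessThan)
  qed
  then show ?thesis
    using sum.nat_group[of "\<lambda>l. F (l div K) (l mod K)" K N] by simp
qed

lemma spanned_by_products:
  fixes h :: "nat \<Rightarrow> 'x \<Rightarrow> real"
  assumes "spanned_by S K P"
    and "\<And>f. f \<in> P' \<Longrightarrow> \<exists>g. (\<forall>i<N. g i \<in> P) \<and> (\<forall>x\<in>S. f x = (\<Sum>i<N. g i x * h i x))"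
  shows "spanned_by S (N * K) P'"
proof -
  from assms(1) obtain B where B: "\<And>f. f \<in> P \<Longrightarrow> \<exists>c. \<forall>x\<in>S. f x = (\<Sum>j<K. c j * B j x)"
    unfolding spanned_by_def by blast
  show ?thesis unfolding spanned_by_def
  proof (rule exI[of _ "\<lambda>l x. B (l mod K) x * h (l div K) x"], rule ballI)
    fix f assume "f \<in> P'"
    then obtain g where g: "\<And>i. i < N \<Longrightarrow> g i \<in> P" "\<forall>x\<in>S. f x = (\<Sum>i<N. g i x * h i x)"
      using assms(2) by blast
    have "\<forall>i. \<exists>c. i < N \<longrightarrow> (\<forall>x\<in>S. g i x = (\<Sum>j<K. c j * B j x))"
      using B g(1) by blast
    then obtain c where c: "\<forall>i. i < N \<longrightarrow> (\<forall>x\<in>S. g i x = (\<Sum>j<K. c i j * B j x))"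
      unfolding choice_iff by blast
    have "f x = (\<Sum>l<N * K. c (l div K) (l mod K) * (B (l mod K) x * h (l div K) x))" if "x \<in> S" for x
    proof -
      have "f x = (\<Sum>i<N. \<Sum>j<K. c i j * (B j x * h i x))"
        using g(2) c that by (auto simp: sum_distrib_right mult.assoc)
      then show ?thesis
        using sum_div_mod[of "\<lambda>i j. c i j * (B j x * h i x)" K N] by simp
    qed
    then show "\<exists>c. \<forall>x\<in>S. f x = (\<Sum>l<N * K. c l * (B (l mod K) x * h (l div K) x))"
      by (intro exI[of _ "\<lambda>l. c (l div K) (l mod K)"]) auto
  qed
qed

lemma underdetermined_system:
  fixes a :: "'i \<Rightarrow> nat \<Rightarrow> real"
  assumes "finite I" "K < card I"
  shows "\<exists>c. (\<exists>i\<in>I. c i \<noteq> 0) \<and> (\<forall>j<K. (\<Sum>i\<in>I. c i * a i j) = 0)"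
  using assms
proof (induction K arbitrary: I a)
  case 0
  then have "I \<noteq> {}" by auto
  then show ?case by (intro exI[of _ "\<lambda>_. 1"]) auto
next
  case (Suc K)
  show ?case
  proof (cases "\<forall>i\<in>I. a i K = 0")
    case True
    obtain c where "\<exists>i\<in>I. c i \<noteq> 0" "\<forall>j<K. (\<Sum>i\<in>I. c i * a i j) = 0"
      using Suc.IH[of I a] Suc.prems by auto
    then show ?thesis using True by (intro exI[of _ c]) (auto simp: less_Suc_eq)
  next
    case False
    then obtain p where p: "p \<in> I" "a p K \<noteq> 0" by blast
    let ?I = "I - {p}"
    have I: "finite ?I" "K < card ?I" using Suc.prems p by auto
    obtain c where c: "\<exists>i\<in>?I. c i \<noteq> 0" "\<forall>j<K. (\<Sum>i\<in>?I. c i * (a i j - a i K / a p K * a p j)) = 0"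
      using Suc.IH[OF I, of "\<lambda>i j. a i j - a i K / a p K * a p j"] by blast
    define c' where "c' = c(p := - (\<Sum>i\<in>?I. c i * a i K / a p K))"
    have sum: "(\<Sum>i\<in>I. c' i * a i j) = (\<Sum>i\<in>?I. c i * (a i j - a i K / a p K * a p j))" for j
    proof -
      have "(\<Sum>i\<in>I. c' i * a i j) = c' p * a p j + (\<Sum>i\<in>?I. c' i * a i j)"
        by (rule sum.remove) (use Suc.prems p in auto)
      also have "(\<Sum>i\<in>?I. c' i * a i j) = (\<Sum>i\<in>?I. c i * a i j)"
        by (rule sum.cong) (auto simp: c'_def)
      also have "c' p * a p j = - (\<Sum>i\<in>?I. c i * (a i K / a p K * a p j))"
        by (simp add: c'_def sum_distrib_left mult_ac)
      finally show ?thesis by (simp add: right_diff_distrib sum_subtractf)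
    qed
    show ?thesis
    proof (intro exI[of _ c'] conjI allI impI)
      show "\<exists>i\<in>I. c' i \<noteq> 0" using c(1) unfolding c'_def by auto
      fix j assume "j < Suc K"
      then show "(\<Sum>i\<in>I. c' i * a i j) = 0"
        unfolding sum using c(2) p(2) by (cases "j = K") auto
    qed
  qed
qed

lemma linear_relation:
  assumes "spanned_by S K P" "finite I" "K < card I" "\<And>i. i \<in> I \<Longrightarrow> G i \<in> P"
  shows "\<exists>c. (\<exists>i\<in>I. c i \<noteq> 0) \<and> (\<forall>x\<in>S. (\<Sum>i\<in>I. c i * G i x) = 0)"
proof -
  from assms(1) obtain B where B: "\<And>f. f \<in> P \<Longrightarrow> \<exists>c. \<forall>x\<in>S. f x = (\<Sum>j<K. c j * B j x)"
    unfolding spanned_by_def by blast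
  have "\<forall>i. \<exists>c. i \<in> I \<longrightarrow> (\<forall>x\<in>S. G i x = (\<Sum>j<K. c j * B j x))"
    using B assms(4) by blast
  then obtain a where a: "\<forall>i. i \<in> I \<longrightarrow> (\<forall>x\<in>S. G i x = (\<Sum>j<K. a i j * B j x))"
    unfolding choice_iff by blast
  obtain c where c: "\<exists>i\<in>I. c i \<noteq> 0" "\<forall>j<K. (\<Sum>i\<in>I. c i * a i j) = 0"
    using underdetermined_system[OF assms(2,3)] by blast
  have "(\<Sum>i\<in>I. c i * G i x) = 0" if "x \<in> S" for x
  proof -
    have "(\<Sum>i\<in>I. c i * G i x) = (\<Sum>i\<in>I. \<Sum>j<K. c i * a i j * B j x)"
      using a that by (auto simp: sum_distrib_left mult.assoc)
    also have "\<dots> = (\<Sum>j<K. (\<Sum>i\<in>I. c i * a i j) * B j x)"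
      unfolding sum_distrib_right by (rule sum.swap)
    also have "\<dots> = 0" using c(2) by simp
    finally show ?thesis .
  qed
  then show ?thesis using c(1) by blast
qed

text \<open>
Every power of u is reduced below N with coefficients whose degree grows linearly in the exponent.
\<close>

lemma integral_reduction:
  assumes int: "integral_over U S u N" and one: "(\<lambda>_. 1) \<in> U"
    and f: "form (insert u U) m f"
  shows "\<exists>c. (\<forall>i<N. form U (N * m) (c i)) \<and> (\<forall>x\<in>S. f x = (\<Sum>i<N. c i x * u x ^ i))"
proof (cases N)
  case 0
  then have "S = {}" using int unfolding integral_over_def by auto
  then show ?thesis using 0 by auto
next
  case (Suc M)
  obtain a where a: "\<forall>i<N. form U (N - i) (a i)" "\<forall>x\<in>S. u x ^ N + (\<Sum>i<N. a i x * u x ^ i) = 0"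
    using int unfolding integral_over_def by blast
  have pow: "\<exists>b. (\<forall>j<N. form U (N * i) (b j)) \<and> (\<forall>x\<in>S. u x ^ i = (\<Sum>j<N. b j x * u x ^ j))" for i
  proof (induction i)
    case 0
    show ?case
      by (rule exI[of _ "\<lambda>j. if j = 0 then (\<lambda>_. 1) else (\<lambda>_. 0)"])
         (auto simp: Suc sum.lessThan_Suc_shift intro: form.const form.zero simp del: sum.lessThan_Suc)
  next
    case (Suc i)
    then obtain b where b: "\<forall>j<N. form U (N * i) (b j)" "\<forall>x\<in>S. u x ^ i = (\<Sum>j<N. b j x * u x ^ j)"
      by blast
    define b' where "b' j = (\<lambda>x. (if j = 0 then 0 else b (j - 1) x) - b M x * a j x)" for j
    show ?case
    proof (intro exI[of _ b'] conjI allI impI ballI)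
      fix j assume j: "j < N"
      have "form U (N * i + (N - j)) (\<lambda>x. b M x * a j x)"
        using a b j \<open>N = Suc M\<close> by (intro form.mult) auto
      then have 1: "form U (N * Suc i) (\<lambda>x. b M x * a j x)"
        by (rule form_raise[OF _ one]) simp
      have "form U (N * i) (\<lambda>x. if j = 0 then 0 else b (j - 1) x)"
        using b(1) j by (cases j) (auto intro: form.zero)
      then have "form U (N * Suc i) (\<lambda>x. if j = 0 then 0 else b (j - 1) x)"
        by (rule form_raise[OF _ one]) simp
      from form_diff[OF this 1] show "form U (N * Suc i) (b' j)" unfolding b'_def .
    next
      fix x assume x: "x \<in> S"
      have "u x ^ Suc i = (\<Sum>j<N. b j x * u x ^ j) * u x"
        using b(2) x by simp
      also have "\<dots> = (\<Sum>j<M. b j x * u x ^ Suc j) + b M x * u x ^ N"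
        by (simp add: \<open>N = Suc M\<close> algebra_simps sum_distrib_left)
      also have "u x ^ N = - (\<Sum>j<N. a j x * u x ^ j)"
        using a(2) x by (simp add: eq_neg_iff_add_eq_0)
      also have "(\<Sum>j<M. b j x * u x ^ Suc j) = (\<Sum>j<N. (if j = 0 then 0 else b (j - 1) x) * u x ^ j)"
        unfolding \<open>N = Suc M\<close> sum.lessThan_Suc_shift by simp
      finally show "u x ^ Suc i = (\<Sum>j<N. b' j x * u x ^ j)"
        unfolding b'_def by (simp add: left_diff_distrib sum_subtractf sum_distrib_left mult.assoc)
    qed
  qed
  then obtain b where "\<forall>i. (\<forall>j<N. form U (N * i) (b i j)) \<and> (\<forall>x\<in>S. u x ^ i = (\<Sum>j<N. b i j x * u x ^ j))"
    using choice_iff[of "\<lambda>i b. (\<forall>j<N. form U (N * i) (b j)) \<and> (\<forall>x\<in>S. u x ^ i = (\<Sum>j<N. b j x * u x ^ j))"]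
    by blast
  then have b: "\<And>i j. j < N \<Longrightarrow> form U (N * i) (b i j)" "\<And>i x. x \<in> S \<Longrightarrow> u x ^ i = (\<Sum>j<N. b i j x * u x ^ j)"
    by blast+
  obtain c where c: "\<forall>i\<le>m. form U (m - i) (c i)" "f = (\<lambda>x. \<Sum>i\<le>m. c i x * u x ^ i)"
    using form_expand_insert[OF f] by blast
  show ?thesis
  proof (intro exI[of _ "\<lambda>j x. \<Sum>i\<le>m. c i x * b i j x"] conjI allI impI ballI)
    fix j assume j: "j < N"
    show "form U (N * m) (\<lambda>x. \<Sum>i\<le>m. c i x * b i j x)"
    proof (rule form_sum)
      fix i assume i: "i \<in> {..m}"
      have "form U ((m - i) + N * i) (\<lambda>x. c i x * b i j x)"
        using c(1) b(1)[OF j] i by (intro form.mult) auto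
      moreover have "(m - i) + N * i \<le> N * m"
      proof -
        have "(m - i) + N * i \<le> N * (m - i) + N * i" using \<open>N = Suc M\<close> by simp
        also have "\<dots> = N * m" using i by (simp flip: distrib_left)
        finally show ?thesis .
      qed
      ultimately show "form U (N * m) (\<lambda>x. c i x * b i j x)"
        by (rule form_raise[OF _ one])
    qed
  next
    fix x assume x: "x \<in> S"
    have "c i x * u x ^ i = (\<Sum>j<N. c i x * (b i j x * u x ^ j))" for i
      by (subst b(2)[OF x, of i]) (rule sum_distrib_left)
    then have "f x = (\<Sum>i\<le>m. \<Sum>j<N. c i x * (b i j x * u x ^ j))"
      unfolding c(2) by (intro sum.cong refl)
    also have "\<dots> = (\<Sum>j<N. (\<Sum>i\<le>m. c i x * b i j x) * u x ^ j)"
      unfolding sum_distrib_right mult.assoc by (rule sum.swap)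
    finally show "f x = (\<Sum>j<N. (\<Sum>i\<le>m. c i x * b i j x) * u x ^ j)" .
  qed
qed

text \<open>
Adding a coordinate multiplies the dimension by m + 1 in general, but only by a constant if that
  coordinate is integral over the earlier ones.
\<close>

theorem growth_of_integral_extension:
  fixes w e :: "nat \<Rightarrow> 'a::euclidean_space"
  assumes dual: "dual_bases w e" and d: "d \<le> DIM('a)"
    and int: "integral_from 1 w d S"
  shows "\<exists>C. \<forall>m. spanned_by S (C * (m + 1) ^ d) {f. form (insert (\<lambda>_. 1) coord_forms) m f}"
proof -
  let ?U = "\<lambda>k. insert (\<lambda>_. 1) (first_forms w k)"
  have "\<exists>C. \<forall>m. spanned_by S (C * (m + 1) ^ min k d) {f. form (?U k) m f}" if "k \<le> DIM('a)" for k
    using that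
  proof (induction k)
    case 0
    have "spanned_by S 1 {f. form (?U 0) m f}" for m
      unfolding spanned_by_def
    proof (rule exI[of _ "\<lambda>_ _. 1"], rule ballI)
      fix f assume "f \<in> {f. form (?U 0) m f}"
      then have "f x = f undefined" for x
        using form_const_gen[of 1 m f x undefined] by (simp add: first_forms_def)
      then have "\<forall>x\<in>S. f x = (\<Sum>i<(1::nat). f undefined * 1)"
        by (simp add: lessThan_Suc)
      then show "\<exists>c. \<forall>x\<in>S. f x = (\<Sum>i<(1::nat). c i * 1)" by (rule exI[of _ "\<lambda>_. f undefined"])
    qed
    then show ?case by (intro exI[of _ 1]) auto
  next
    case (Suc k)
    then obtain C where C: "\<And>m. spanned_by S (C * (m + 1) ^ min k d) {f. form (?U k) m f}"
      by auto
    have ins: "?U (Suc k) = insert (\<lambda>x. w k \<bullet> x) (?U k)"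
      unfolding first_forms_Suc by auto
    show ?case
    proof (cases "k < d")
      case True
      have "spanned_by S (Suc m * (C * (m + 1) ^ min k d)) {f. form (?U (Suc k)) m f}" for m
      proof (rule spanned_by_products[OF C[of m]])
        fix f assume "f \<in> {f. form (?U (Suc k)) m f}"
        then obtain c where c: "\<forall>i\<le>m. form (?U k) (m - i) (c i)" "f = (\<lambda>x. \<Sum>i\<le>m. c i x * (w k \<bullet> x) ^ i)"
          unfolding ins using form_expand_insert by blast
        have "form (?U k) m (c i)" if "i < Suc m" for i
          using c(1) that by (intro form_raise[of "?U k" "m - i" "c i" m]) auto
        then show "\<exists>g. (\<forall>i<Suc m. g i \<in> {f. form (?U k) m f}) \<and> (\<forall>x\<in>S. f x = (\<Sum>i<Suc m. g i x * (w k \<bullet> x) ^ i))"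
          using c(2) by (intro exI[of _ c]) (auto simp: lessThan_Suc_atMost)
      qed
      then show ?thesis using True by (intro exI[of _ C]) (simp add: mult_ac)
    next
      case False
      then obtain N where N: "integral_over (?U k) S (\<lambda>x. w k \<bullet> x) N"
        using integral_fromD[OF int, of k] Suc.prems by auto
      have "spanned_by S (N * (C * (N * m + 1) ^ min k d)) {f. form (?U (Suc k)) m f}" for m
        by (rule spanned_by_products[OF C[of "N * m"], where h = "\<lambda>i x. (w k \<bullet> x) ^ i"])
           (use integral_reduction[OF N] in \<open>auto simp: ins\<close>)
      moreover have "N * (C * (N * m + 1) ^ min k d) \<le> (N * C * (N + 1) ^ d) * (m + 1) ^ d" for m
      proof -
        have "N * m + 1 \<le> (N + 1) * (m + 1)" by simp
        then have "(N * m + 1) ^ d \<le> ((N + 1) * (m + 1)) ^ d" by (rule power_mono) simp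
        then have "(N * C) * (N * m + 1) ^ d \<le> (N * C) * ((N + 1) * (m + 1)) ^ d" by (rule mult_left_mono) simp
        moreover have "(N * C) * ((N + 1) * (m + 1)) ^ d = (N * C * (N + 1) ^ d) * (m + 1) ^ d"
          unfolding power_mult_distrib by (rule mult.assoc[symmetric])
        moreover have "N * (C * (N * m + 1) ^ min k d) = (N * C) * (N * m + 1) ^ d"
          using False by (simp only: min_absorb2 mult.assoc not_less)
        ultimately show ?thesis by (simp only:)
      qed
      ultimately have "spanned_by S ((N * C * (N + 1) ^ d) * (m + 1) ^ d) {f. form (?U (Suc k)) m f}" for m
        by (rule spanned_by_mono) auto
      moreover have "min (Suc k) d = d" using False by simp
      ultimately show ?thesis by (intro exI[of _ "N * C * (N + 1) ^ d"]) simp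
    qed
  qed
  from this[of "DIM('a)"] obtain C where
    "\<And>m. spanned_by S (C * (m + 1) ^ d) {f. form (?U DIM('a)) m f}"
    unfolding min_absorb2[OF d] by blast
  then have "spanned_by S (C * (m + 1) ^ d) {f. form (insert (\<lambda>_. 1) coord_forms) m f}" for m
    by (rule spanned_by_mono) (auto intro: form_dual_bases[OF dual])
  then show ?thesis by blast
qed

section \<open>Monomials and Kronecker substitution\<close>

text \<open>
The number N encodes, by its digits in base b, the exponents of a monomial with all exponents
  below b.
\<close>

definition digit :: "nat \<Rightarrow> nat \<Rightarrow> nat \<Rightarrow> nat" where
  "digit b N i = N div b ^ i mod b"

definition digit_monomial :: "nat \<Rightarrow> nat \<Rightarrow> nat \<Rightarrow> (nat \<Rightarrow> real) \<Rightarrow> real" where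
  "digit_monomial b k N y = (\<Prod>i<k. y i ^ digit b N i)"

lemma digit_expansion: "(\<Sum>i<k. b ^ i * digit b N i) = N mod b ^ k"
proof (induction k)
  case (Suc k)
  have "N mod b ^ Suc k = N mod (b ^ k * b)" by (simp add: mult.commute)
  also have "\<dots> = b ^ k * (N div b ^ k mod b) + N mod b ^ k" by (rule mod_mult2_eq)
  finally show ?case using Suc.IH by (simp add: digit_def)
qed simp

text \<open>
Kronecker substitution makes distinct monomials into distinct powers of one variable, which
  proves that monomials are linearly independent.
\<close>

lemma digit_monomial_kronecker:
  assumes "N < b ^ k" "\<And>i. i < k \<Longrightarrow> y i = t ^ (b ^ i)"
  shows "digit_monomial b k N y = t ^ N"
proof -
  have "digit_monomial b k N y = (\<Prod>i<k. t ^ (b ^ i * digit b N i))"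
    unfolding digit_monomial_def using assms(2) by (simp add: power_mult)
  also have "\<dots> = t ^ (\<Sum>i<k. b ^ i * digit b N i)"
    by (simp add: power_sum)
  finally show ?thesis using digit_expansion[of b N k] assms(1) by simp
qed

lemma digit_sum_le: "(\<Sum>i<k. digit (Suc r) N i) \<le> k * r"
proof -
  have "(\<Sum>i<k. digit (Suc r) N i) \<le> (\<Sum>i<k. r)"
    by (rule sum_mono) (simp add: digit_def less_Suc_eq_le[symmetric])
  then show ?thesis by simp
qed

lemma form_digit_monomial:
  "k \<le> l \<Longrightarrow> form (first_forms w l) (\<Sum>i<k. digit b N i) (\<lambda>x. digit_monomial b k N (\<lambda>i. w i \<bullet> x))"
  unfolding digit_monomial_def by (intro form_prod form_gen_power first_formsI) auto

lemma kronecker_coeffs_zero: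
  fixes c :: "nat \<Rightarrow> real"
  assumes "\<And>t. (\<Sum>N<M. c N * t ^ N) = 0" "N < M"
  shows "c N = 0"
proof -
  obtain M' where M: "M = Suc M'" using assms(2) by (cases M) auto
  have "\<forall>t. (\<Sum>N\<le>M'. c N * t ^ N) = 0" using assms(1) by (simp add: M lessThan_Suc_atMost)
  then have "\<forall>i\<le>M'. c i = 0" unfolding polyfun_eq_0 .
  then show ?thesis using assms(2) M by simp
qed

lemma growth_gap:
  fixes C p d :: nat
  assumes "0 < p" "r = C * p ^ d"
  shows "C * (p * r + 1) ^ d < (r + 1) ^ Suc d"
proof -
  have "p * r + 1 \<le> p * (r + 1)" using assms(1) by simp
  then have "(p * r + 1) ^ d \<le> (p * (r + 1)) ^ d" by (rule power_mono) simp
  then have "C * (p * r + 1) ^ d \<le> C * (p * (r + 1)) ^ d" by (rule mult_left_mono) simp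
  also have "\<dots> = r * (r + 1) ^ d" unfolding power_mult_distrib by (simp add: assms(2))
  also have "\<dots> < (r + 1) ^ Suc d" by simp
  finally show ?thesis .
qed

text \<open>
Suppose that there are d + 2 forms. The monomials in the first d + 1 of them with exponents at
  most r, made homogeneous by a power of the next form, are (r + 1)^(d + 1) functions of degree
  (d + 1) r. For large r this exceeds the dimension available on S, so they are linearly dependent
  on S. Independence carries the relation over to the whole space, where it is impossible.
\<close>

theorem independent_forms_le_growth:
  fixes w e :: "nat \<Rightarrow> 'a::euclidean_space"
  assumes dual: "dual_bases w e" and k: "k \<le> DIM('a)"
    and growth: "\<And>m. spanned_by S (C * (m + 1) ^ d) {f. form (insert (\<lambda>_. 1) coord_forms) m f}"
    and indep: "independent_on \<epsilon> w k S"
  shows "k \<le> Suc d"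
proof (rule ccontr)
  assume "\<not> k \<le> Suc d"
  define p where "p = Suc d"
  then have p: "p < k" using \<open>\<not> k \<le> Suc d\<close> by simp
  define r where "r = C * p ^ d"
  define m where "m = p * r"
  define b where "b = Suc r"
  define G where "G N x = digit_monomial b p N (\<lambda>i. w i \<bullet> x) * (w p \<bullet> x) ^ (m - (\<Sum>i<p. digit b N i))"
    for N and x :: 'a
  have G: "form (first_forms w k) m (G N)" for N
  proof -
    have "form (first_forms w k) ((\<Sum>i<p. digit b N i) + (m - (\<Sum>i<p. digit b N i))) (G N)"
      unfolding G_def by (intro form.mult form_digit_monomial form_gen_power first_formsI) (use p in auto)
    moreover have "(\<Sum>i<p. digit b N i) \<le> m"
      unfolding b_def m_def by (rule digit_sum_le)
    ultimately show ?thesis by simp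
  qed
  have "\<exists>c. (\<exists>N\<in>{..<b ^ p}. c N \<noteq> 0) \<and> (\<forall>x\<in>S. (\<Sum>N\<in>{..<b ^ p}. c N * G N x) = 0)"
  proof (rule linear_relation[OF growth])
    show "C * (m + 1) ^ d < card {..<b ^ p}"
      using growth_gap[of p r C d] by (simp add: p_def r_def m_def b_def)
    show "G N \<in> {f. form (insert (\<lambda>_. 1) coord_forms) m f}" for N
    proof -
      have "form (insert (\<lambda>_. 1) coord_forms) m (G N)"
      proof (rule form_subst[OF G])
        fix u assume "u \<in> first_forms w k"
        then obtain i where "u = (\<lambda>x. w i \<bullet> x)" by (auto simp: first_forms_def)
        then show "form (insert (\<lambda>_. 1) coord_forms) (Suc 0) u"
          using form_mono[OF form_linear[of "w i"]] by blast
      qed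
      then show ?thesis by simp
    qed
  qed simp
  then obtain c N where c: "N < b ^ p" "c N \<noteq> 0" "\<forall>x\<in>S. (\<Sum>N<b ^ p. c N * G N x) = 0"
    by blast
  have zero: "(\<Sum>N<b ^ p. c N * G N x) = 0" for x
  proof (rule independent_onD[OF indep])
    show "form (insert (\<lambda>_. \<epsilon>) (first_forms w k)) m (\<lambda>x. \<Sum>N<b ^ p. c N * G N x)"
      by (rule form_mono[OF form_sum[OF form_cmult[OF G]]]) auto
  qed (use c(3) in blast)
  have "(\<Sum>N<b ^ p. c N * t ^ N) = 0" for t
  proof -
    define a where "a i = (if i = p then 1 else t ^ (b ^ i))" for i
    define x where "x = (\<Sum>i<Suc p. a i *\<^sub>R e i)"
    have coord: "w i \<bullet> x = a i" if "i < Suc p" for i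
      unfolding x_def using dual_bases_coordinates[OF dual, of i "Suc p" a] that p k by simp
    have "G N x = t ^ N" if "N < b ^ p" for N
      unfolding G_def using digit_monomial_kronecker[OF that, of "\<lambda>i. w i \<bullet> x" t] coord
      by (simp add: a_def)
    then show ?thesis using zero[of x] by simp
  qed
  then have "c N = 0" by (rule kronecker_coeffs_zero) (rule c(1))
  then show False using c(2) by simp
qed

section \<open>Real points near a regular point\<close>

lemma sign_change_of_derivative:
  fixes g :: "real \<Rightarrow> real"
  assumes "(g has_real_derivative D) (at 0)" "D \<noteq> 0" "g 0 = 0" "0 < r"
  shows "\<exists>s>0. s < r \<and> g s * g (- s) < 0"
proof -
  have pos: "\<exists>s>0. s < r \<and> g s * g (- s) < 0"
    if D: "(g has_real_derivative D) (at 0)" "D > 0" and g: "g 0 = 0" for g :: "real \<Rightarrow> real" and D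
  proof -
    obtain a where a: "a > 0" "\<forall>h>0. h < a \<longrightarrow> g 0 < g (0 + h)"
      using DERIV_pos_inc_right[OF D] by blast
    obtain b where b: "b > 0" "\<forall>h>0. h < b \<longrightarrow> g (0 - h) < g 0"
      using DERIV_pos_inc_left[OF D] by blast
    define s where "s = min r (min a b) / 2"
    have s: "s > 0" "s < r" "s < a" "s < b"
      using assms(4) a(1) b(1) by (auto simp: s_def min_def)
    then have "g s > 0" "g (- s) < 0" using a(2) b(2) g by auto
    then show ?thesis using s by (intro exI[of _ s]) (auto simp: mult_pos_neg)
  qed
  show ?thesis
  proof (cases "D > 0")
    case True
    then show ?thesis using pos[OF assms(1) _ assms(3)] by blast
  next
    case False
    have "((\<lambda>x. - g x) has_real_derivative - D) (at 0)"
      using assms(1) by (rule DERIV_minus)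
    then show ?thesis using pos[of "\<lambda>x. - g x" "- D"] False assms(2,3) by auto
  qed
qed

lemma zero_of_sign_change:
  fixes h :: "real \<Rightarrow> real"
  assumes "continuous_on UNIV h" "0 < s" "h s * h (- s) < 0"
  shows "\<exists>t. \<bar>t\<bar> \<le> s \<and> h t = 0"
proof -
  have cont: "continuous_on {- s..s} h" using assms(1) continuous_on_subset by blast
  show ?thesis
  proof (cases "h s > 0")
    case True
    then have "h (- s) \<le> 0" using assms(3) by (simp add: mult_less_0_iff)
    then obtain t where "- s \<le> t" "t \<le> s" "h t = 0"
      using IVT'[of h "- s" 0 s] cont True assms(2) by auto
    then show ?thesis by (intro exI[of _ t]) auto
  next
    case False
    then have "h (- s) \<ge> 0" "h s \<le> 0" using assms(3) by (auto simp: mult_less_0_iff)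
    then obtain t where "- s \<le> t" "t \<le> s" "h t = 0"
      using IVT2'[of h s 0 "- s"] cont assms(2) by auto
    then show ?thesis by (intro exI[of _ t]) auto
  qed
qed

text \<open>
The coordinates d, d + 1, \<dots> of x are determined one after the other. Equation k involves only
  the coordinates up to k and has a simple zero at q, so its sign changes along e k near q; the
  same sign change holds at nearby points, and the intermediate value theorem provides the value
  of coordinate k. This is the implicit function theorem without the uniqueness of the solution.
\<close>

lemma triangular_system_solvable:
  fixes w e :: "nat \<Rightarrow> 'a::euclidean_space" and p :: "nat \<Rightarrow> 'a \<Rightarrow> real"
  assumes dual: "dual_bases w e" and d: "d \<le> DIM('a)"
    and cont: "\<And>j. d \<le> j \<Longrightarrow> j < DIM('a) \<Longrightarrow> continuous_on UNIV (p j)"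
    and dep: "\<And>j x y. d \<le> j \<Longrightarrow> j < DIM('a) \<Longrightarrow> (\<And>i. i \<le> j \<Longrightarrow> w i \<bullet> x = w i \<bullet> y) \<Longrightarrow> p j x = p j y"
    and zero: "\<And>j. d \<le> j \<Longrightarrow> j < DIM('a) \<Longrightarrow> p j q = 0"
    and deriv: "\<And>j. d \<le> j \<Longrightarrow> j < DIM('a) \<Longrightarrow>
       \<exists>D. D \<noteq> 0 \<and> ((\<lambda>t. p j (q + t *\<^sub>R e j)) has_real_derivative D) (at 0)"
    and \<epsilon>: "0 < \<epsilon>"
  shows "\<exists>\<delta>>0. \<forall>y. norm (y - q) < \<delta> \<longrightarrow>
     (\<exists>x. norm (x - q) < \<epsilon> \<and> (\<forall>i<d. w i \<bullet> x = w i \<bullet> y) \<and> (\<forall>j. d \<le> j \<longrightarrow> j < DIM('a) \<longrightarrow> p j x = 0))"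
proof -
  have "\<exists>\<delta>>0. \<forall>y. norm (y - q) < \<delta> \<longrightarrow>
     (\<exists>x. norm (x - q) < \<epsilon> \<and> (\<forall>i<d. w i \<bullet> x = w i \<bullet> y) \<and>
       (\<forall>i. k \<le> i \<longrightarrow> i < DIM('a) \<longrightarrow> w i \<bullet> x = w i \<bullet> q) \<and> (\<forall>j. d \<le> j \<longrightarrow> j < k \<longrightarrow> p j x = 0))"
    if "d \<le> k" "k \<le> DIM('a)" "0 < \<epsilon>" for k \<epsilon>
    using that
  proof (induction k arbitrary: \<epsilon> rule: dec_induct)
    case base
    define B where "B = (\<Sum>i<d. norm (w i) * norm (e i))"
    have B: "B \<ge> 0" unfolding B_def by (intro sum_nonneg) auto
    show ?case
    proof (intro exI[of _ "\<epsilon> / (B + 1)"] conjI allI impI)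
      show "0 < \<epsilon> / (B + 1)" using base B by auto
      fix y assume y: "norm (y - q) < \<epsilon> / (B + 1)"
      define z where "z = (\<Sum>i<d. (w i \<bullet> (y - q)) *\<^sub>R e i)"
      have coord: "w j \<bullet> z = (if j < d then w j \<bullet> (y - q) else 0)" if "j < DIM('a)" for j
        unfolding z_def by (rule dual_bases_coordinates[OF dual that d])
      have "norm z \<le> (\<Sum>i<d. norm ((w i \<bullet> (y - q)) *\<^sub>R e i))"
        unfolding z_def by (rule norm_sum)
      also have "\<dots> \<le> (\<Sum>i<d. norm (y - q) * (norm (w i) * norm (e i)))"
      proof (rule sum_mono)
        fix i
        have "\<bar>w i \<bullet> (y - q)\<bar> * norm (e i) \<le> (norm (w i) * norm (y - q)) * norm (e i)"
          by (rule mult_right_mono[OF Cauchy_Schwarz_ineq2]) simp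
        then show "norm ((w i \<bullet> (y - q)) *\<^sub>R e i) \<le> norm (y - q) * (norm (w i) * norm (e i))"
          by (simp add: mult_ac)
      qed
      also have "\<dots> = norm (y - q) * B" unfolding B_def by (simp add: sum_distrib_left)
      also have "\<dots> \<le> norm (y - q) * (B + 1)" by (rule mult_left_mono) auto
      also have "\<dots> < \<epsilon>" using y B by (simp add: pos_less_divide_eq)
      finally have "norm z < \<epsilon>" .
      then show "\<exists>x. norm (x - q) < \<epsilon> \<and> (\<forall>i<d. w i \<bullet> x = w i \<bullet> y) \<and>
        (\<forall>i. d \<le> i \<longrightarrow> i < DIM('a) \<longrightarrow> w i \<bullet> x = w i \<bullet> q) \<and> (\<forall>j. d \<le> j \<longrightarrow> j < d \<longrightarrow> p j x = 0)"
        using coord d by (intro exI[of _ "q + z"]) (auto simp: inner_add_right inner_diff_right)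
    qed
  next
    case (step k)
    then have k: "k < DIM('a)" by simp
    obtain D where D: "D \<noteq> 0" "((\<lambda>t. p k (q + t *\<^sub>R e k)) has_real_derivative D) (at 0)"
      using deriv[of k] step k by auto
    have "\<exists>s>0. s < \<epsilon> / (2 * (norm (e k) + 1)) \<and> p k (q + s *\<^sub>R e k) * p k (q + (- s) *\<^sub>R e k) < 0"
      by (rule sign_change_of_derivative[OF D(2,1)])
         (use zero[of k] step k in \<open>auto intro!: divide_pos_pos add_nonneg_pos\<close>)
    then obtain s where s: "s > 0" "s < \<epsilon> / (2 * (norm (e k) + 1))"
      "p k (q + s *\<^sub>R e k) * p k (q + (- s) *\<^sub>R e k) < 0" by blast
    have contk: "continuous_on UNIV (p k)" using cont[of k] step k by auto
    have cont_shift: "continuous_on UNIV (\<lambda>x. p k (x + t *\<^sub>R e k))" for t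
      by (rule continuous_on_compose2[OF contk]) (auto intro!: continuous_intros)
    have "open {x. p k (x + s *\<^sub>R e k) * p k (x + (- s) *\<^sub>R e k) < 0}"
      by (intro open_Collect_less continuous_on_mult cont_shift continuous_on_const)
    then obtain \<eta> where \<eta>: "\<eta> > 0"
      "ball q \<eta> \<subseteq> {x. p k (x + s *\<^sub>R e k) * p k (x + (- s) *\<^sub>R e k) < 0}"
      using s(3) unfolding open_contains_ball by blast
    obtain \<delta> where \<delta>: "\<delta> > 0" "\<And>y. norm (y - q) < \<delta> \<Longrightarrow>
     (\<exists>x. norm (x - q) < min \<eta> (\<epsilon> / 2) \<and> (\<forall>i<d. w i \<bullet> x = w i \<bullet> y) \<and>
       (\<forall>i. k \<le> i \<longrightarrow> i < DIM('a) \<longrightarrow> w i \<bullet> x = w i \<bullet> q) \<and> (\<forall>j. d \<le> j \<longrightarrow> j < k \<longrightarrow> p j x = 0))"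
      using step.IH[of "min \<eta> (\<epsilon> / 2)"] \<eta>(1) step.prems by auto
    show ?case
    proof (intro exI[of _ \<delta>] conjI allI impI)
      fix y assume "norm (y - q) < \<delta>"
      then obtain x where x: "norm (x - q) < \<eta>" "norm (x - q) < \<epsilon> / 2" "\<forall>i<d. w i \<bullet> x = w i \<bullet> y"
        "\<forall>i. k \<le> i \<longrightarrow> i < DIM('a) \<longrightarrow> w i \<bullet> x = w i \<bullet> q" "\<forall>j. d \<le> j \<longrightarrow> j < k \<longrightarrow> p j x = 0"
        using \<delta>(2) by (metis min_less_iff_conj)
      have "x \<in> ball q \<eta>" using x(1) by (simp add: dist_norm norm_minus_commute)
      then have "p k (x + s *\<^sub>R e k) * p k (x + (- s) *\<^sub>R e k) < 0" using \<eta>(2) by blast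
      moreover have "continuous_on UNIV (\<lambda>t. p k (x + t *\<^sub>R e k))"
        by (rule continuous_on_compose2[OF contk]) (auto intro!: continuous_intros)
      ultimately obtain t where t: "\<bar>t\<bar> \<le> s" "p k (x + t *\<^sub>R e k) = 0"
        using zero_of_sign_change[of "\<lambda>t. p k (x + t *\<^sub>R e k)" s] s(1) by auto
      define x' where "x' = x + t *\<^sub>R e k"
      have other: "w i \<bullet> x' = w i \<bullet> x" if "i \<noteq> k" "i < DIM('a)" for i
        using dual_bases_inner[OF dual that(2) k] that(1) by (simp add: x'_def inner_add_right)
      have "norm (x' - q) \<le> norm (x - q) + norm (t *\<^sub>R e k)"
        unfolding x'_def using norm_triangle_ineq[of "x - q" "t *\<^sub>R e k"] by (simp add: algebra_simps)
      also have "norm (t *\<^sub>R e k) \<le> s * (norm (e k) + 1)"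
        using t(1) s(1) by (auto intro!: mult_mono)
      also have "s * (norm (e k) + 1) < \<epsilon> / 2"
      proof -
        have "0 < 2 * (norm (e k) + 1)" by (simp add: add_nonneg_pos)
        then have "s * (2 * (norm (e k) + 1)) < \<epsilon>" using s(2) by (simp only: pos_less_divide_eq)
        then show ?thesis by (simp add: algebra_simps)
      qed
      finally have "norm (x' - q) < \<epsilon>" using x(2) by simp
      moreover have "p j x' = 0" if "d \<le> j" "j < Suc k" for j
      proof (cases "j = k")
        case False
        then have "p j x' = p j x"
          using that k by (intro dep other) auto
        then show ?thesis using x(5) that False by auto
      qed (use t in \<open>simp add: x'_def\<close>)
      moreover have "\<forall>i<d. w i \<bullet> x' = w i \<bullet> y"
        using other x(3) step.hyps d by auto
      moreover have "\<forall>i. Suc k \<le> i \<longrightarrow> i < DIM('a) \<longrightarrow> w i \<bullet> x' = w i \<bullet> q"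
        using other x(4) by auto
      ultimately show "\<exists>x. norm (x - q) < \<epsilon> \<and> (\<forall>i<d. w i \<bullet> x = w i \<bullet> y) \<and>
       (\<forall>i. Suc k \<le> i \<longrightarrow> i < DIM('a) \<longrightarrow> w i \<bullet> x = w i \<bullet> q) \<and> (\<forall>j. d \<le> j \<longrightarrow> j < Suc k \<longrightarrow> p j x = 0)"
        by blast
    qed (rule \<delta>(1))
  qed
  from this[OF d order_refl \<epsilon>] obtain \<delta> where "\<delta> > 0" "\<forall>y. norm (y - q) < \<delta> \<longrightarrow>
     (\<exists>x. norm (x - q) < \<epsilon> \<and> (\<forall>i<d. w i \<bullet> x = w i \<bullet> y) \<and>
       (\<forall>i. DIM('a) \<le> i \<longrightarrow> i < DIM('a) \<longrightarrow> w i \<bullet> x = w i \<bullet> q) \<and> (\<forall>j. d \<le> j \<longrightarrow> j < DIM('a) \<longrightarrow> p j x = 0))"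
    by blast
  then show ?thesis by blast
qed

section \<open>Chains of irreducible sets\<close>

text \<open>
The vanishing ideal of an irreducible set is prime.
\<close>

lemma irreducible_common_nonzero:
  assumes irr: "irreducible_algebraic_set V" and fin: "finite J"
    and poly: "\<And>j. j \<in> J \<Longrightarrow> real_polynomial_function (F j)"
    and nz: "\<And>j. j \<in> J \<Longrightarrow> \<exists>x\<in>V. F j x \<noteq> 0"
  shows "\<exists>x\<in>V. \<forall>j\<in>J. F j x \<noteq> 0"
proof -
  have prime: "\<exists>x\<in>V. f x * g x \<noteq> 0"
    if f: "real_polynomial_function f" "\<exists>x\<in>V. f x \<noteq> 0"
      and g: "real_polynomial_function g" "\<exists>x\<in>V. g x \<noteq> 0" for f g
  proof (rule ccontr)
    assume "\<not> (\<exists>x\<in>V. f x * g x \<noteq> 0)"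
    then have "V = {x \<in> V. f x = 0} \<union> {x \<in> V. g x = 0}" by auto
    moreover have "algebraic_set {x \<in> V. f x = 0}" "algebraic_set {x \<in> V. g x = 0}"
      using irr f g unfolding irreducible_algebraic_set_def by (auto intro: algebraic_Int_zeros)
    moreover have "{x \<in> V. f x = 0} \<subset> V" "{x \<in> V. g x = 0} \<subset> V" using f g by auto
    ultimately show False using irr unfolding irreducible_algebraic_set_def by blast
  qed
  have "\<exists>x\<in>V. (\<Prod>j\<in>J. F j x) \<noteq> 0" "real_polynomial_function (\<lambda>x. \<Prod>j\<in>J. F j x)"
    using fin poly nz
  proof (induction J rule: finite_induct)
    case empty
    case 1
    show ?case using irr unfolding irreducible_algebraic_set_def by auto
    case 2
    show ?case by auto
  next
    case (insert j J)
    case 1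
    then show ?case
      using insert.IH prime[of "F j" "\<lambda>x. \<Prod>j\<in>J. F j x"] insert.hyps by simp
    case 2
    then show ?case using insert.IH insert.hyps by (simp add: real_polynomial_function.intros(4))
  qed
  then show ?thesis using fin by auto
qed

text \<open>
The derivative of a monic equation of degree N, divided by N, is again monic and compatible
  with total degree. If N is minimal, it cannot vanish on S.
\<close>

lemma minimal_degree_separable:
  assumes "S \<noteq> {}" and "\<exists>N. integral_over U S u N"
  obtains N c where "0 < N" "integral_over U S u N" "\<And>i. i < N \<Longrightarrow> form U (N - i) (c i)"
    "\<And>x. x \<in> S \<Longrightarrow> u x ^ N + (\<Sum>i<N. c i x * u x ^ i) = 0"
    "\<exists>x\<in>S. real N * u x ^ (N - 1) + (\<Sum>i<N. c i x * (real i * u x ^ (i - 1))) \<noteq> 0"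
proof -
  define N where "N = (LEAST N. integral_over U S u N)"
  have N: "integral_over U S u N" unfolding N_def using assms(2) by (rule LeastI_ex)
  then obtain c where c: "\<And>i. i < N \<Longrightarrow> form U (N - i) (c i)"
    "\<And>x. x \<in> S \<Longrightarrow> u x ^ N + (\<Sum>i<N. c i x * u x ^ i) = 0"
    unfolding integral_over_def by blast
  have "N \<noteq> 0" using c(2) assms(1) by fastforce
  then obtain M where M: "N = Suc M" by (cases N) auto
  have "\<exists>x\<in>S. real N * u x ^ (N - 1) + (\<Sum>i<N. c i x * (real i * u x ^ (i - 1))) \<noteq> 0"
  proof (rule ccontr)
    assume neg: "\<not> (\<exists>x\<in>S. real N * u x ^ (N - 1) + (\<Sum>i<N. c i x * (real i * u x ^ (i - 1))) \<noteq> 0)"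
    have "integral_over U S u M"
      unfolding integral_over_def
    proof (intro exI[of _ "\<lambda>i x. (real (Suc i) / real N) * c (Suc i) x"] conjI allI impI ballI)
      fix i assume "i < M"
      then have "form U (M - i) (c (Suc i))" using c(1)[of "Suc i"] M by simp
      then show "form U (M - i) (\<lambda>x. real (Suc i) / real N * c (Suc i) x)" by (rule form_cmult)
    next
      fix x assume "x \<in> S"
      then have "0 = real N * u x ^ M + (\<Sum>i<Suc M. c i x * (real i * u x ^ (i - 1)))"
        using neg M by auto
      also have "\<dots> = real N * u x ^ M + (\<Sum>i<M. c (Suc i) x * (real (Suc i) * u x ^ i))"
        by (simp add: sum.lessThan_Suc_shift del: sum.lessThan_Suc)
      also have "\<dots> = real N * (u x ^ M + (\<Sum>i<M. (real (Suc i) / real N) * c (Suc i) x * u x ^ i))"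
        using \<open>N \<noteq> 0\<close> by (simp add: distrib_left sum_distrib_left mult_ac del: of_nat_Suc)
      finally show "u x ^ M + (\<Sum>i<M. (real (Suc i) / real N) * c (Suc i) x * u x ^ i) = 0"
        using \<open>N \<noteq> 0\<close> by simp
    qed
    then have "N \<le> M" unfolding N_def by (rule Least_le)
    then show False using M by simp
  qed
  then show ?thesis using that \<open>N \<noteq> 0\<close> N c by blast
qed

text \<open>
A polynomial f is algebraic over the first d coordinates on any set of growth O(m^d): the products
  of powers of f with monomials in these coordinates outnumber the dimension. K is the lowest
  power of f whose coefficient is not identically zero.
\<close>

lemma algebraic_relation:
  fixes w e :: "nat \<Rightarrow> 'a::euclidean_space"
  assumes dual: "dual_bases w e" and d: "d \<le> DIM('a)"
    and growth: "\<And>m. spanned_by S (C * (m + 1) ^ d) {f. form (insert (\<lambda>_. 1) coord_forms) m f}"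
    and f: "real_polynomial_function f"
  shows "\<exists>A K b m. K < (b :: nat) \<and> (\<forall>x\<in>S. (\<Sum>i\<in>{K..<b}. f x ^ i * A i x) = 0) \<and>
    (\<forall>i. form (insert (\<lambda>_. 1) (first_forms w d)) m (A i)) \<and> (\<exists>x. A K x \<noteq> 0)"
proof -
  let ?P = "insert (\<lambda>_. 1) (coord_forms :: ('a \<Rightarrow> real) set)"
  obtain D where D: "form ?P D f"
    using f real_polynomial_function_iff_form by blast
  define p where "p = Suc (D + d)"
  define r where "r = C * p ^ d"
  define b where "b = Suc r"
  define I where "I = {..<b} \<times> {..<b ^ d}"
  define mon where "mon N x = digit_monomial b d N (\<lambda>i. w i \<bullet> x)" for N and x :: 'a
  have mon: "form (insert (\<lambda>_. 1) (first_forms w d)) (d * r) (mon N)" for N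
  proof -
    have "form (first_forms w d) (\<Sum>i<d. digit b N i) (mon N)"
      unfolding mon_def by (rule form_digit_monomial) simp
    then have "form (insert (\<lambda>_. 1) (first_forms w d)) (\<Sum>i<d. digit b N i) (mon N)"
      by (rule form_mono) auto
    then show ?thesis
      by (rule form_raise) (auto simp: b_def digit_sum_le)
  qed
  have sub: "form ?P (Suc 0) u" if "u \<in> insert (\<lambda>_. 1) (first_forms w d)" for u
  proof (cases "u = (\<lambda>_. 1)")
    case False
    then have "u \<in> first_forms w d" using that by simp
    then obtain i where "u = (\<lambda>x. w i \<bullet> x)" unfolding first_forms_def by blast
    then show ?thesis using form_mono[OF form_linear[of "w i"]] by blast
  qed (auto intro: form.gen)
  have "\<exists>c. (\<exists>i\<in>I. c i \<noteq> 0) \<and> (\<forall>x\<in>S. (\<Sum>i\<in>I. c i * (f x ^ fst i * mon (snd i) x)) = 0)"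
  proof (rule linear_relation[OF growth])
    show "finite I" by (simp add: I_def)
    show "C * (p * r + 1) ^ d < card I"
      using growth_gap[of p r C d] by (simp add: I_def p_def r_def b_def)
    fix i assume "i \<in> I"
    then have i: "fst i \<le> r" by (auto simp: I_def b_def)
    have "form ?P (D * fst i + d * r) (\<lambda>x. f x ^ fst i * mon (snd i) x)"
      by (intro form.mult form_power D form_subst[OF mon sub])
    moreover have "D * fst i + d * r \<le> p * r"
    proof -
      have "D * fst i \<le> D * r" using i by simp
      then have "D * fst i + d * r \<le> (D + d) * r" by (simp add: distrib_right)
      also have "\<dots> \<le> p * r" by (simp add: p_def)
      finally show ?thesis .
    qed
    ultimately have "form ?P (p * r) (\<lambda>x. f x ^ fst i * mon (snd i) x)"
      using form_raise[of ?P _ "\<lambda>x. f x ^ fst i * mon (snd i) x" "p * r"] by blast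
    then show "(\<lambda>x. f x ^ fst i * mon (snd i) x) \<in> {f. form ?P (p * r) f}" by simp
  qed
  then obtain c i0 where c: "i0 \<in> I" "c i0 \<noteq> 0" "\<forall>x\<in>S. (\<Sum>i\<in>I. c i * (f x ^ fst i * mon (snd i) x)) = 0"
    by blast
  define A where "A i x = (\<Sum>N<b ^ d. c (i, N) * mon N x)" for i x
  define Q where "Q i \<longleftrightarrow> (\<exists>N<b ^ d. c (i, N) \<noteq> 0)" for i
  define K where "K = (LEAST i. Q i)"
  have "Q (fst i0)" using c(1,2) unfolding Q_def I_def by (cases i0) auto
  then have K: "Q K" "K \<le> fst i0" unfolding K_def by (auto intro: LeastI Least_le)
  have low: "A i x = 0" if "i < K" for i x
  proof -
    have "\<not> Q i" using that unfolding K_def by (rule not_less_Least)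
    then show ?thesis unfolding A_def Q_def by simp
  qed
  show ?thesis
  proof (rule exI[of _ A], rule exI[of _ K], rule exI[of _ b], rule exI[of _ "d * r"], intro conjI ballI allI)
    show Kb: "K < b" using K(2) c(1) by (auto simp: I_def)
    show "(\<Sum>i\<in>{K..<b}. f x ^ i * A i x) = 0" if "x \<in> S" for x
    proof -
      have "0 = (\<Sum>i\<in>I. c i * (f x ^ fst i * mon (snd i) x))" using c(3) that by simp
      also have "\<dots> = (\<Sum>i<b. \<Sum>N<b ^ d. c (i, N) * (f x ^ i * mon N x))"
        unfolding I_def by (simp add: sum.cartesian_product split_def)
      also have "\<dots> = (\<Sum>i<b. f x ^ i * A i x)"
        unfolding A_def by (simp add: sum_distrib_left mult_ac)
      also have "\<dots> = (\<Sum>i\<in>{K..<b}. f x ^ i * A i x)"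
        by (rule sum.mono_neutral_right) (use low in auto)
      finally show ?thesis by simp
    qed
    show "form (insert (\<lambda>_. 1) (first_forms w d)) (d * r) (A i)" for i
      unfolding A_def by (intro form_sum form_cmult mon)
    show "\<exists>x. A K x \<noteq> 0"
    proof (rule ccontr)
      assume "\<not> (\<exists>x. A K x \<noteq> 0)"
      then have zero: "A K x = 0" for x by blast
      have sum0: "(\<Sum>N<b ^ d. c (K, N) * t ^ N) = 0" for t
      proof -
        \<comment> \<open>Kronecker substitution at a point with these coordinates.\<close>
        define x where "x = (\<Sum>i<d. t ^ (b ^ i) *\<^sub>R e i)"
        have "w i \<bullet> x = t ^ (b ^ i)" if "i < d" for i
          unfolding x_def using dual_bases_coordinates[OF dual, of i d "\<lambda>i. t ^ (b ^ i)"] that d by simp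
        then have monx: "mon N x = t ^ N" if "N < b ^ d" for N
          unfolding mon_def by (intro digit_monomial_kronecker[OF that])
        show ?thesis using zero[of x] unfolding A_def by (simp add: monx)
      qed
      have "c (K, N) = 0" if "N < b ^ d" for N
        by (rule kronecker_coeffs_zero[where c = "\<lambda>N. c (K, N)", OF sum0 that])
      then show False using K(1) unfolding Q_def by blast
    qed
  qed
qed

text \<open>
Let M be the zero set of the minimal integral equations, which contains V, and let V be the zero
  set of f. Then M has growth O(m^d), so f satisfies a relation f^K H = 0 on M whose factor H equals
  the lowest coefficient A K wherever f vanishes. Choose q in V with A K q \<noteq> 0 at which the
  integral equations are separable. Near q the factor H does not vanish, so M and V coincide there,
  and M projects onto a neighbourhood.
\<close>

lemma open_projection:
  fixes V :: "(real^'n) set" and w e :: "nat \<Rightarrow> real^'n"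
  assumes irr: "irreducible_algebraic_set V" and dual: "dual_bases w e" and d: "d \<le> DIM(real^'n)"
    and indep: "independent_on 1 w d V"
    and int: "integral_from 1 w d V"
  shows "\<exists>q\<in>V. \<exists>\<delta>>0. \<forall>y. norm (y - q) < \<delta> \<longrightarrow> (\<exists>x\<in>V. \<forall>i<d. w i \<bullet> x = w i \<bullet> y)"
proof -
  let ?U = "\<lambda>j. insert (\<lambda>_. 1) (first_forms w j)"
  let ?n = "DIM(real^'n)"
  have alg: "algebraic_set V" and ne: "V \<noteq> {}"
    using irr unfolding irreducible_algebraic_set_def by auto
  define R where "R j N c \<longleftrightarrow> 0 < N \<and> (\<forall>i<N. form (?U j) (N - i) (c i)) \<and>
      (\<forall>x\<in>V. (w j \<bullet> x) ^ N + (\<Sum>i<N. c i x * (w j \<bullet> x) ^ i) = 0) \<and>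
      (\<exists>x\<in>V. real N * (w j \<bullet> x) ^ (N - 1) + (\<Sum>i<N. c i x * (real i * (w j \<bullet> x) ^ (i - 1))) \<noteq> 0)"
    for j N and c :: "nat \<Rightarrow> real^'n \<Rightarrow> real"
  have "\<exists>N c. R j N c" if j: "d \<le> j" "j < ?n" for j
    by (rule minimal_degree_separable[OF ne integral_fromD[OF int j]]) (auto simp: R_def)
  then have "\<exists>Nc. d \<le> j \<longrightarrow> j < ?n \<longrightarrow> R j (fst Nc) (snd Nc)" for j
    by (cases "d \<le> j \<and> j < ?n") auto
  then have "\<forall>j. \<exists>Nc. d \<le> j \<longrightarrow> j < ?n \<longrightarrow> R j (fst Nc) (snd Nc)" ..
  from choice[OF this] obtain Nc where Nc: "\<forall>j. d \<le> j \<longrightarrow> j < ?n \<longrightarrow> R j (fst (Nc j)) (snd (Nc j))" ..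
  define N where "N j = fst (Nc j)" for j
  define c where "c j = snd (Nc j)" for j
  have R: "R j (N j) (c j)" if "d \<le> j" "j < ?n" for j
    using spec[OF Nc, of j] that unfolding N_def c_def by simp
  define p where "p j x = (w j \<bullet> x) ^ N j + (\<Sum>i<N j. c j i x * (w j \<bullet> x) ^ i)" for j x
  define p' where "p' j x = real (N j) * (w j \<bullet> x) ^ (N j - 1) +
      (\<Sum>i<N j. c j i x * (real i * (w j \<bullet> x) ^ (i - 1)))" for j x
  define M where "M = {x. \<forall>j. d \<le> j \<longrightarrow> j < ?n \<longrightarrow> p j x = 0}"
  have VM: "V \<subseteq> M"
    using R unfolding M_def p_def R_def by blast
  have N: "integral_over (?U j) M (\<lambda>x. w j \<bullet> x) (N j)" if j: "d \<le> j" "j < ?n" for j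
    unfolding integral_over_def
    using R[OF j] j by (intro exI[of _ "c j"]) (auto simp: R_def M_def p_def)
  have "integral_from 1 w d M"
    unfolding integral_from_def using N by blast
  then obtain C where C: "\<And>m. spanned_by M (C * (m + 1) ^ d) {f. form (insert (\<lambda>_. 1) coord_forms) m f}"
    using growth_of_integral_extension[OF dual d] by blast
  obtain f where f: "real_polynomial_function f" "V = {x. f x = 0}"
    using algebraic_single_equation[OF alg] by blast
  obtain A K b m where A: "K < (b :: nat)" "\<And>x. x \<in> M \<Longrightarrow> (\<Sum>i\<in>{K..<b}. f x ^ i * A i x) = 0"
    "\<And>i. form (?U d) m (A i)" "\<exists>x. A K x \<noteq> 0"
    using algebraic_relation[OF dual d C f(1)] by blast
  have c_poly: "real_polynomial_function (c j i)" if "d \<le> j" "j < ?n" "i < N j" for i j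
    using R[OF that(1,2)] that(3) unfolding R_def by (blast intro: form_first_forms_polynomial)
  have p_poly: "real_polynomial_function (p j)" "real_polynomial_function (p' j)"
    if "d \<le> j" "j < ?n" for j
    unfolding p_def p'_def using c_poly[OF that]
    by (auto intro!: real_polynomial_function.intros(3,4) real_polynomial_function.intros(2)
        real_polynomial_function_power real_polynomial_function_sum real_polynomial_function_inner_left)
  have A_poly: "real_polynomial_function (A i)" for i
    using A(3) by (rule form_first_forms_polynomial)
  have "\<exists>x\<in>V. A K x \<noteq> 0" using independent_onD[OF indep A(3)] A(4) by blast
  moreover have "\<exists>x\<in>V. p' j x \<noteq> 0" if "d \<le> j" "j < ?n" for j
    using R[OF that] unfolding R_def p'_def by blast
  ultimately have "\<exists>x\<in>V. \<forall>j\<in>{d..?n}. (if j < ?n then p' j else A K) x \<noteq> 0"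
    using p_poly A_poly by (intro irreducible_common_nonzero[OF irr]) auto
  then obtain q where q: "q \<in> V" "\<forall>j\<in>{d..?n}. (if j < ?n then p' j else A K) q \<noteq> 0"
    by blast
  have qA: "A K q \<noteq> 0"
    using bspec[OF q(2), of ?n] d by auto
  have qp: "p' j q \<noteq> 0" if "d \<le> j" "j < ?n" for j
    using bspec[OF q(2), of j] that by auto
  \<comment> \<open>The relation on M divided by the power K of f.\<close>
  define H where "H x = A K x + f x * (\<Sum>i\<in>{Suc K..<b}. f x ^ (i - Suc K) * A i x)" for x
  have H: "f x ^ K * H x = 0" if "x \<in> M" for x
  proof -
    have "0 = (\<Sum>i\<in>{K..<b}. f x ^ i * A i x)" using A(2)[OF that] by simp
    also have "\<dots> = f x ^ K * A K x + (\<Sum>i\<in>{Suc K..<b}. f x ^ i * A i x)"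
      using A(1) by (simp add: sum.atLeast_Suc_lessThan)
    also have "(\<Sum>i\<in>{Suc K..<b}. f x ^ i * A i x) =
        (\<Sum>i\<in>{Suc K..<b}. f x ^ K * (f x * (f x ^ (i - Suc K) * A i x)))"
    proof (rule sum.cong[OF refl])
      fix i assume "i \<in> {Suc K..<b}"
      then have "f x ^ i = f x ^ (K + Suc (i - Suc K))" by simp
      also have "\<dots> = f x ^ K * (f x * f x ^ (i - Suc K))" unfolding power_add power_Suc ..
      finally show "f x ^ i * A i x = f x ^ K * (f x * (f x ^ (i - Suc K) * A i x))" by simp
    qed
    finally show ?thesis unfolding H_def by (simp add: distrib_left sum_distrib_left)
  qed
  have "real_polynomial_function H"
    unfolding H_def using f(1) A_poly
    by (auto intro!: real_polynomial_function.intros(3,4) real_polynomial_function_power real_polynomial_function_sum)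
  then have "continuous_on UNIV H"
    by (simp add: continuous_at_imp_continuous_on continuous_real_polymonial_function)
  then have "open {x. H x \<noteq> 0}" by (intro open_Collect_neq continuous_on_const)
  moreover have "H q \<noteq> 0" using qA q(1) f(2) by (simp add: H_def)
  ultimately obtain \<epsilon> where \<epsilon>: "\<epsilon> > 0" "ball q \<epsilon> \<subseteq> {x. H x \<noteq> 0}"
    unfolding open_contains_ball by blast
  have "\<exists>\<delta>>0. \<forall>y. norm (y - q) < \<delta> \<longrightarrow>
     (\<exists>x. norm (x - q) < \<epsilon> \<and> (\<forall>i<d. w i \<bullet> x = w i \<bullet> y) \<and> (\<forall>j. d \<le> j \<longrightarrow> j < ?n \<longrightarrow> p j x = 0))"
  proof (rule triangular_system_solvable[OF dual d _ _ _ _ \<epsilon>(1)])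
    fix j assume j: "d \<le> j" "j < ?n"
    show "continuous_on UNIV (p j)"
      using p_poly(1)[OF j] by (simp add: continuous_at_imp_continuous_on continuous_real_polymonial_function)
    show "p j q = 0" using VM q(1) j unfolding M_def by blast
    have c_dep: "c j i x = c j i y" if "i < N j" "\<And>i. i < j \<Longrightarrow> w i \<bullet> x = w i \<bullet> y" for i x y
      by (rule form_cong_point[of "?U j" "N j - i"])
         (use R[OF j] that in \<open>auto simp: R_def first_forms_def\<close>)
    show "p j x = p j y" if "\<And>i. i \<le> j \<Longrightarrow> w i \<bullet> x = w i \<bullet> y" for x y
      unfolding p_def using c_dep[of _ x y] that by simp
    have wj: "w j \<bullet> (q + t *\<^sub>R e j) = w j \<bullet> q + t" for t
      using dual_bases_inner[OF dual j(2) j(2)] by (simp add: inner_add_right)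
    have cj: "c j i (q + t *\<^sub>R e j) = c j i q" if "i < N j" for i t
      by (rule c_dep[OF that])
         (use dual_bases_inner[OF dual _ j(2)] j(2) in \<open>auto simp: inner_add_right\<close>)
    have "(\<lambda>t. p j (q + t *\<^sub>R e j)) = (\<lambda>t. (w j \<bullet> q + t) ^ N j + (\<Sum>i<N j. c j i q * (w j \<bullet> q + t) ^ i))"
      unfolding p_def wj using cj by simp
    moreover have "((\<lambda>t. (w j \<bullet> q + t) ^ N j + (\<Sum>i<N j. c j i q * (w j \<bullet> q + t) ^ i))
        has_real_derivative p' j q) (at 0)"
      unfolding p'_def by (auto intro!: derivative_eq_intros sum.cong simp: mult_ac)
    ultimately show "\<exists>D. D \<noteq> 0 \<and> ((\<lambda>t. p j (q + t *\<^sub>R e j)) has_real_derivative D) (at 0)"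
      using qp[OF j] by auto
  qed
  then obtain \<delta> where \<delta>: "\<delta> > 0" "\<And>y. norm (y - q) < \<delta> \<Longrightarrow>
     (\<exists>x. norm (x - q) < \<epsilon> \<and> (\<forall>i<d. w i \<bullet> x = w i \<bullet> y) \<and> (\<forall>j. d \<le> j \<longrightarrow> j < ?n \<longrightarrow> p j x = 0))"
    by blast
  show ?thesis
  proof (rule bexI[OF _ q(1)], rule exI[of _ \<delta>], intro conjI allI impI \<delta>(1))
    fix y assume "norm (y - q) < \<delta>"
    then obtain x where x: "norm (x - q) < \<epsilon>" "\<forall>i<d. w i \<bullet> x = w i \<bullet> y" "x \<in> M"
      using \<delta>(2)[of y] unfolding M_def by blast
    have "x \<in> ball q \<epsilon>" using x(1) by (simp add: dist_norm norm_minus_commute)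
    then have "H x \<noteq> 0" using \<epsilon>(2) by blast
    then have "f x = 0" using H[OF x(3)] by simp
    then show "\<exists>x\<in>V. \<forall>i<d. w i \<bullet> x = w i \<bullet> y" using x(2) f(2) by blast
  qed
qed

text \<open>
If V = A \<union> B and the coordinates are dependent on A and on B, the product of the two relations is
  a relation on V. So a minimal set with independent coordinates is irreducible.
\<close>

lemma irreducible_independent_subset:
  fixes Y :: "(real^'n) set" and w :: "nat \<Rightarrow> real^'n"
  assumes "algebraic_set Y"
    and "independent_on 1 w d Y"
  obtains V where "irreducible_algebraic_set V" "V \<subseteq> Y"
    "independent_on 1 w d V"
proof -
  let ?U = "insert (\<lambda>_. 1) (first_forms w d)"
  let ?P = "independent_on 1 w d"
  obtain V where V: "algebraic_set V" "V \<subseteq> Y" "?P V"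
    "\<And>A. algebraic_set A \<Longrightarrow> A \<subset> V \<Longrightarrow> \<not> ?P A"
    using minimal_algebraic_subset[of Y ?P, OF assms] by blast
  have "irreducible_algebraic_set V"
    unfolding irreducible_algebraic_set_def
  proof (intro conjI notI V(1))
    assume "V = {}"
    moreover have "form ?U 0 (\<lambda>_. 1)" by (rule form.const)
    ultimately show False using independent_onD[OF V(3), of 0 "\<lambda>_. 1"] by simp
  next
    assume "\<exists>A B. algebraic_set A \<and> algebraic_set B \<and> A \<subset> V \<and> B \<subset> V \<and> V = A \<union> B"
    then obtain A B where AB: "\<not> ?P A" "\<not> ?P B" "V = A \<union> B" using V(4) by blast
    obtain m f x where f: "form ?U m f" "\<forall>x\<in>A. f x = 0" "f x \<noteq> 0"
      using AB(1) unfolding independent_on_def by blast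
    obtain k g y where g: "form ?U k g" "\<forall>x\<in>B. g x = 0" "g y \<noteq> 0"
      using AB(2) unfolding independent_on_def by blast
    have "\<forall>x\<in>V. f x * g x = 0" using f(2) g(2) AB(3) by auto
    then have "f x * g x = 0" for x
      using independent_onD[OF V(3) form.mult[OF f(1) g(1)]] by blast
    then show False
      using nonzero_mult_polynomial[OF form_first_forms_polynomial[OF f(1)]
          form_first_forms_polynomial[OF g(1)] f(3) g(3)] by blast
  qed
  then show ?thesis using V(2,3) by (rule that)
qed

text \<open>
Induction on d. An irreducible V \<subseteq> Y with d independent coordinates is the top of the chain. In the
  slice W of V through a point q on which coordinate d - 1 is constant, the first d - 1 coordinates
  are still independent, because the projection of V contains a neighbourhood of the image of q;
  coordinate d - 1 is integral over the constants.
\<close>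

theorem chain_of_independent_forms:
  fixes Y :: "(real^'n) set" and w e :: "nat \<Rightarrow> real^'n"
  assumes "algebraic_set Y" and dual: "dual_bases w e" and "d \<le> DIM(real^'n)"
    and "independent_on 1 w d Y"
    and "integral_from 1 w d Y"
  shows "\<exists>Z :: nat \<Rightarrow> (real^'n) set.
     (\<forall>i\<le>d. irreducible_algebraic_set (Z i) \<and> Z i \<subseteq> Y) \<and> (\<forall>i<d. Z i \<subset> Z (Suc i))"
  using assms(1,3-)
proof (induction d arbitrary: Y)
  case (0 Y)
  obtain V where V: "irreducible_algebraic_set V" "V \<subseteq> Y"
    by (rule irreducible_independent_subset[OF 0(1,3)])
  then show ?case by (intro exI[of _ "\<lambda>_. V"]) auto
next
  case (Suc k Y)
  let ?n = "DIM(real^'n)"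
  have k: "k < ?n" using Suc.prems(2) by simp
  obtain V where V: "irreducible_algebraic_set V" "V \<subseteq> Y" "independent_on 1 w (Suc k) V"
    by (rule irreducible_independent_subset[OF Suc.prems(1,3)])
  have int: "integral_from 1 w (Suc k) V"
    by (rule integral_from_subset[OF Suc.prems(4) V(2)])
  obtain q \<delta> where q: "q \<in> V" "0 < \<delta>"
    "\<And>y. norm (y - q) < \<delta> \<Longrightarrow> \<exists>x\<in>V. \<forall>i<Suc k. w i \<bullet> x = w i \<bullet> y"
    using open_projection[OF V(1) dual Suc.prems(2) V(3) int] by blast
  define W where "W = {x \<in> V. w k \<bullet> x - w k \<bullet> q = 0}"
  have algV: "algebraic_set V" using V(1) unfolding irreducible_algebraic_set_def by blast
  have algW: "algebraic_set W"
    unfolding W_def by (rule algebraic_Int_zeros[OF algV])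
      (auto intro: real_polynomial_function_diff real_polynomial_function_inner_left)
  have "W \<noteq> V"
  proof
    assume "W = V"
    have "form (insert (\<lambda>_. 1) (first_forms w (Suc k))) (Suc 0) (\<lambda>x. w k \<bullet> x - w k \<bullet> q)"
      by (rule form_diff[OF form.gen form_raise[OF form.const]]) (auto intro: first_formsI)
    then have "w k \<bullet> (q + e k) - w k \<bullet> q = 0"
      by (rule independent_onD[OF V(3)]) (use \<open>W = V\<close> W_def in blast)
    then show False using dual_bases_inner[OF dual k k] by (simp add: inner_add_right)
  qed
  then have WV: "W \<subset> V" unfolding W_def by blast
  have "g x = 0" if g: "form (insert (\<lambda>_. 1) (first_forms w k)) m g" "\<forall>x\<in>W. g x = 0" for m g x
  proof (rule ccontr)
    assume "g x \<noteq> 0"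
    define O' where "O' = {y. norm ((y + (w k \<bullet> q - w k \<bullet> y) *\<^sub>R e k) - q) < \<delta>}"
    have "open O'" unfolding O'_def by (intro open_Collect_less continuous_intros)
    moreover have "q \<in> O'" using q(2) by (simp add: O'_def)
    ultimately obtain y where y: "y \<in> O'" "g y \<noteq> 0"
      using nonzero_polynomial_on_open[OF form_first_forms_polynomial[OF g(1)] _ _ \<open>g x \<noteq> 0\<close>] by blast
    \<comment> \<open>Moving y into the slice through q; this keeps all coordinates except k.\<close>
    define y' where "y' = y + (w k \<bullet> q - w k \<bullet> y) *\<^sub>R e k"
    obtain x' where x': "x' \<in> V" "\<forall>i<Suc k. w i \<bullet> x' = w i \<bullet> y'"
      using q(3)[of y'] y(1) unfolding y'_def O'_def by blast
    have "w i \<bullet> y' = (if i = k then w k \<bullet> q else w i \<bullet> y)" if "i < Suc k" for i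
      using dual_bases_inner[OF dual _ k, of i] that k by (auto simp: y'_def inner_add_right)
    then have x'w: "w i \<bullet> x' = (if i = k then w k \<bullet> q else w i \<bullet> y)" if "i < Suc k" for i
      using x'(2) that by simp
    have "x' \<in> W" using x'(1) x'w[of k] by (simp add: W_def)
    then have "g x' = 0" using g(2) by blast
    moreover have "g x' = g y"
      by (rule form_cong_point[OF g(1)]) (use x'w in \<open>auto simp: first_forms_def\<close>)
    ultimately show False using y(2) by simp
  qed
  then have indepW: "independent_on 1 w k W"
    unfolding independent_on_def by blast
  have "\<exists>N. integral_over (insert (\<lambda>_. 1) (first_forms w j)) W (\<lambda>x. w j \<bullet> x) N"
    if j: "k \<le> j" "j < ?n" for j
  proof (cases "j = k")
    case True
    have "integral_over (insert (\<lambda>_. 1) (first_forms w k)) W (\<lambda>x. w k \<bullet> x) 1"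
      unfolding integral_over_def
    proof (intro exI[of _ "\<lambda>_ _. - (w k \<bullet> q)"] conjI allI impI ballI)
      show "form (insert (\<lambda>_. 1) (first_forms w k)) (1 - i) (\<lambda>_. - (w k \<bullet> q))" for i
        by (rule form_raise[OF form.const]) auto
    qed (auto simp: W_def)
    then show ?thesis using True by blast
  next
    case False
    then obtain N where "integral_over (insert (\<lambda>_. 1) (first_forms w j)) V (\<lambda>x. w j \<bullet> x) N"
      using integral_fromD[OF int, of j] j by auto
    then have "integral_over (insert (\<lambda>_. 1) (first_forms w j)) W (\<lambda>x. w j \<bullet> x) N"
      by (rule integral_over_subst[OF _ form.gen]) (use WV in auto)
    then show ?thesis by blast
  qed
  then have intW: "integral_from 1 w k W"
    unfolding integral_from_def by blast
  obtain Z where Z: "\<And>i. i \<le> k \<Longrightarrow> irreducible_algebraic_set (Z i) \<and> Z i \<subseteq> W" "\<And>i. i < k \<Longrightarrow> Z i \<subset> Z (Suc i)"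
    using Suc.IH[OF algW less_imp_le[OF k] indepW intW] by blast
  show ?case
  proof (intro exI[of _ "\<lambda>i. if i \<le> k then Z i else V"] conjI allI impI)
    fix i
    show "irreducible_algebraic_set (if i \<le> k then Z i else V)" using Z(1) V(1) by auto
    show "(if i \<le> k then Z i else V) \<subseteq> Y" using Z(1)[of i] V(2) WV by auto
    assume "i < Suc k"
    then show "(if i \<le> k then Z i else V) \<subset> (if Suc i \<le> k then Z (Suc i) else V)"
      using Z(1)[of i] Z(2)[of i] WV by auto
  qed
qed

theorem growth_le_variety_dim:
  fixes Y :: "(real^'n) set"
  assumes "algebraic_set Y" "Y \<noteq> {}"
  shows "\<exists>d C. enat d \<le> variety_dim Y \<and>
    (\<forall>m. spanned_by Y (C * (m + 1) ^ d) {f. form (insert (\<lambda>_. 1) coord_forms) m f})"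
proof -
  obtain w e :: "nat \<Rightarrow> real^'n" and d where w: "d \<le> DIM(real^'n)" "dual_bases w e"
    "integral_from 1 w d Y" "independent_on 1 w d Y"
    using noether_normalization[OF assms(2), of 1] by blast
  obtain C where C: "\<And>m. spanned_by Y (C * (m + 1) ^ d) {f. form (insert (\<lambda>_. 1) coord_forms) m f}"
    using growth_of_integral_extension[OF w(2,1,3)] by blast
  have "enat d \<le> variety_dim Y"
    unfolding variety_dim_def
    by (rule Sup_upper) (use chain_of_independent_forms[OF assms(1) w(2,1,4,3)] in blast)
  then show ?thesis using C by blast
qed

section \<open>Growth of the difference set\<close>

text \<open>
Sums of products of a form in x and a form in y, that is, elements of a tensor square.
\<close>

inductive bisum :: "('x \<Rightarrow> real) set \<Rightarrow> nat \<Rightarrow> ('x \<Rightarrow> 'x \<Rightarrow> real) \<Rightarrow> bool" for U m where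
  zero: "bisum U m (\<lambda>_ _. 0)"
| add: "form U m g \<Longrightarrow> form U m h \<Longrightarrow> bisum U m F \<Longrightarrow> bisum U m (\<lambda>x y. g x * h y + F x y)"

lemma bisum_add: "bisum U m F \<Longrightarrow> bisum U m G \<Longrightarrow> bisum U m (\<lambda>x y. F x y + G x y)"
proof (induction rule: bisum.induct)
  case (add g h F)
  then show ?case using bisum.add[of U m g h "\<lambda>x y. F x y + G x y"] by (simp add: add.assoc)
qed simp

lemma bisum_single: "form U m g \<Longrightarrow> form U m h \<Longrightarrow> bisum U m (\<lambda>x y. g x * h y)"
  using bisum.add[OF _ _ bisum.zero] by simp

lemma bisum_mult_single:
  assumes "bisum U m F" "form U k g" "form U k h"
  shows "bisum U (m + k) (\<lambda>x y. F x y * (g x * h y))"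
  using assms(1)
proof (induction rule: bisum.induct)
  case (add g' h' F)
  have "bisum U (m + k) (\<lambda>x y. (g' x * g x) * (h' y * h y) + F x y * (g x * h y))"
    by (rule bisum.add[OF form.mult form.mult add.IH]) (use add assms in auto)
  then show ?case by (simp add: algebra_simps)
qed (simp add: bisum.zero)

lemma bisum_mult: "bisum U k G \<Longrightarrow> bisum U m F \<Longrightarrow> bisum U (m + k) (\<lambda>x y. F x y * G x y)"
proof (induction rule: bisum.induct)
  case (add g h G)
  then show ?case
    using bisum_add[OF bisum_mult_single[OF add.prems add.hyps(1,2)] add.IH[OF add.prems]]
    by (simp add: distrib_left)
qed (simp add: bisum.zero)

lemma form_difference:
  assumes "form (insert (\<lambda>_. 1) coord_forms) m f"
  shows "bisum (insert (\<lambda>_. 1) coord_forms) m (\<lambda>x y. f (x - y))"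
  using assms
proof induction
  case (const c)
  show ?case using bisum_single[OF form.const[of _ c] form.const[of _ 1]] by simp
next
  case (gen u)
  let ?U = "insert (\<lambda>_. 1) coord_forms :: ('a \<Rightarrow> real) set"
  have one: "form ?U (Suc 0) (\<lambda>_. 1)" by (rule form.gen) simp
  show ?case
  proof (cases "u = (\<lambda>_. 1)")
    case True
    then show ?thesis using bisum_single[OF one one] by simp
  next
    case False
    then obtain b where u: "u = (\<lambda>x. b \<bullet> x)" using gen by (auto simp: coord_forms_def)
    have fu: "form ?U (Suc 0) u" using gen by (rule form.gen)
    from bisum_add[OF bisum_single[OF fu one] bisum_single[OF one form_uminus[OF fu]]]
    show ?thesis by (simp add: u inner_diff_right)
  qed
qed (auto intro: bisum.zero bisum_add bisum_mult)

lemma spanned_by_difference_set: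
  fixes X :: "(real^'n) set"
  assumes "spanned_by X K {f. form (insert (\<lambda>_. 1) coord_forms) m f}"
  shows "spanned_by (difference_set X) (K * K) {f. form (insert (\<lambda>_. 1) coord_forms) m f}"
proof -
  from assms obtain B where B: "\<And>f. form (insert (\<lambda>_. 1) coord_forms) m f \<Longrightarrow> \<exists>c. \<forall>x\<in>X. f x = (\<Sum>i<K. c i * B i x)"
    unfolding spanned_by_def by blast
  have "\<exists>c. \<forall>x\<in>X. \<forall>y\<in>X. F x y = (\<Sum>i<K. \<Sum>j<K. c i j * (B i x * B j y))"
    if "bisum (insert (\<lambda>_. 1) coord_forms) m F" for F :: "real^'n \<Rightarrow> real^'n \<Rightarrow> real"
    using that
  proof (induction rule: bisum.induct)
    case zero
    show ?case by (intro exI[of _ "\<lambda>_ _. 0"]) simp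
  next
    case (add g h F)
    then obtain a where a: "\<forall>x\<in>X. \<forall>y\<in>X. F x y = (\<Sum>i<K. \<Sum>j<K. a i j * (B i x * B j y))" by blast
    obtain b c where b: "\<forall>x\<in>X. g x = (\<Sum>i<K. b i * B i x)" and c: "\<forall>x\<in>X. h x = (\<Sum>i<K. c i * B i x)"
      using B[OF add.hyps(1)] B[OF add.hyps(2)] by blast
    have "g x * h y + F x y = (\<Sum>i<K. \<Sum>j<K. (b i * c j + a i j) * (B i x * B j y))"
      if "x \<in> X" "y \<in> X" for x y
    proof -
      have "g x * h y = (\<Sum>i<K. \<Sum>j<K. (b i * c j) * (B i x * B j y))"
        using b c that by (simp add: sum_product mult_ac)
      then show ?thesis using a that by (simp add: distrib_right sum.distrib)
    qed
    then show ?case by (intro exI[of _ "\<lambda>i j. b i * c j + a i j"]) blast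
  qed
  then have rep: "\<exists>c. \<forall>x\<in>X. \<forall>y\<in>X. f (x - y) = (\<Sum>i<K. \<Sum>j<K. c i j * (B i x * B j y))"
    if "form (insert (\<lambda>_. 1) coord_forms) m f" for f :: "real^'n \<Rightarrow> real"
    using form_difference[OF that] by blast
  have "\<forall>z. \<exists>p. z \<in> difference_set X \<longrightarrow> fst p \<in> X \<and> snd p \<in> X \<and> z = fst p - snd p"
    unfolding difference_set_def by auto
  from choice[OF this] obtain p where p: "\<forall>z. z \<in> difference_set X \<longrightarrow>
      fst (p z) \<in> X \<and> snd (p z) \<in> X \<and> z = fst (p z) - snd (p z)" ..
  show ?thesis unfolding spanned_by_def
  proof (rule exI[of _ "\<lambda>l z. B (l div K) (fst (p z)) * B (l mod K) (snd (p z))"], rule ballI)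
    fix f :: "real^'n \<Rightarrow> real" assume "f \<in> {f. form (insert (\<lambda>_. 1) coord_forms) m f}"
    then obtain c where c: "\<forall>x\<in>X. \<forall>y\<in>X. f (x - y) = (\<Sum>i<K. \<Sum>j<K. c i j * (B i x * B j y))"
      using rep by blast
    have "f z = (\<Sum>l<K * K. c (l div K) (l mod K) * (B (l div K) (fst (p z)) * B (l mod K) (snd (p z))))"
      if "z \<in> difference_set X" for z
    proof -
      have z: "fst (p z) \<in> X" "snd (p z) \<in> X" "z = fst (p z) - snd (p z)" using p that by blast+
      have "f z = f (fst (p z) - snd (p z))" using z(3) by simp
      also have "\<dots> = (\<Sum>i<K. \<Sum>j<K. c i j * (B i (fst (p z)) * B j (snd (p z))))"
        using c z(1,2) by blast
      also have "\<dots> = (\<Sum>l<K * K. c (l div K) (l mod K) * (B (l div K) (fst (p z)) * B (l mod K) (snd (p z))))"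
        by (rule sum_div_mod[symmetric])
      finally show ?thesis .
    qed
    then show "\<exists>c. \<forall>z\<in>difference_set X. f z =
        (\<Sum>l<K * K. c l * (B (l div K) (fst (p z)) * B (l mod K) (snd (p z))))"
      by (intro exI[of _ "\<lambda>l. c (l div K) (l mod K)"]) blast
  qed
qed

section \<open>Projections of sets of slow growth\<close>

text \<open>
If v were larger, every term on the right could be estimated by a multiple of T v^(N-1).
\<close>

lemma root_bound:
  fixes v T :: real
  assumes "0 \<le> v" "0 \<le> T" "\<And>i. i < N \<Longrightarrow> 0 \<le> a i" "v ^ N \<le> (\<Sum>i<N. a i * T ^ (N - i) * v ^ i)"
  shows "v \<le> (1 + (\<Sum>i<N. a i)) * T"
proof (rule ccontr)
  define A where "A = (\<Sum>i<N. a i)"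
  have A: "0 \<le> A" unfolding A_def using assms(3) by (intro sum_nonneg) auto
  assume "\<not> v \<le> (1 + (\<Sum>i<N. a i)) * T"
  then have v: "(1 + A) * T < v" by (simp add: A_def)
  then have Tv: "T < v" "A * T < v"
    using v assms(2) mult_nonneg_nonneg[OF A assms(2)] unfolding distrib_right by linarith+
  have v0: "0 < v" using Tv assms(2) by simp
  have "N \<noteq> 0" using assms(4) by (intro notI) simp
  then obtain M where M: "N = Suc M" by (cases N) auto
  have "(\<Sum>i<N. a i * T ^ (N - i) * v ^ i) \<le> (\<Sum>i<N. a i * (T * v ^ M))"
  proof (rule sum_mono)
    fix i assume i: "i \<in> {..<N}"
    then have "T ^ (N - i) * v ^ i = T * (T ^ (M - i) * v ^ i)"
      using M by (simp add: Suc_diff_le)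
    also have "\<dots> \<le> T * (v ^ (M - i) * v ^ i)"
      using assms(1,2) Tv by (intro mult_left_mono mult_right_mono power_mono) auto
    also have "v ^ (M - i) * v ^ i = v ^ M"
      using i M by (simp flip: power_add)
    finally have "T ^ (N - i) * v ^ i \<le> T * v ^ M" .
    then show "a i * T ^ (N - i) * v ^ i \<le> a i * (T * v ^ M)"
      using assms(3)[of i] i by (simp add: mult.assoc mult_left_mono)
  qed
  also have "\<dots> = (A * T) * v ^ M" unfolding A_def sum_distrib_right mult.assoc ..
  also have "\<dots> < v * v ^ M" using Tv(2) v0 by (intro mult_strict_right_mono) auto
  finally show False using assms(4) M by simp
qed

text \<open>
A homogeneous monic equation bounds the size of u on S by a multiple of the size of the
  coordinates below it, with no additive constant. This is the reason for homogeneous relations: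
  the bound remains valid near 0 and at infinity.
\<close>

lemma norm_le_of_integral_from:
  fixes w e :: "nat \<Rightarrow> 'a::euclidean_space"
  assumes dual: "dual_bases w e" and k: "k \<le> DIM('a)" and int: "integral_from 0 w k S"
  shows "\<exists>C\<ge>0. \<forall>x\<in>S. norm x \<le> C * (\<Sum>i<k. \<bar>w i \<bullet> x\<bar>)"
proof -
  define s where "s x = (\<Sum>i<k. \<bar>w i \<bullet> x\<bar>)" for x
  have s0: "0 \<le> s x" for x unfolding s_def by (intro sum_nonneg) auto
  have "\<exists>C\<ge>0. \<forall>x\<in>S. \<forall>i<j. \<bar>w i \<bullet> x\<bar> \<le> C * s x" if "k \<le> j" "j \<le> DIM('a)" for j
    using that
  proof (induction j rule: dec_induct)
    case base
    have "\<bar>w i \<bullet> x\<bar> \<le> 1 * s x" if "i < k" for i x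
      unfolding s_def using member_le_sum[of i "{..<k}" "\<lambda>i. \<bar>w i \<bullet> x\<bar>"] that by simp
    then show ?case by (intro exI[of _ 1]) auto
  next
    case (step j)
    then obtain C where C: "C \<ge> 0" "\<forall>x\<in>S. \<forall>i<j. \<bar>w i \<bullet> x\<bar> \<le> C * s x" by auto
    obtain N where "integral_over (insert (\<lambda>_. 0) (first_forms w j)) S (\<lambda>x. w j \<bullet> x) N"
      using integral_fromD[OF int, of j] step by auto
    then obtain c where c: "\<forall>i<N. form (insert (\<lambda>_. 0) (first_forms w j)) (N - i) (c i)"
      "\<forall>x\<in>S. (w j \<bullet> x) ^ N + (\<Sum>i<N. c i x * (w j \<bullet> x) ^ i) = 0"
      unfolding integral_over_def by blast
    have "\<forall>i. \<exists>a. i < N \<longrightarrow> 0 \<le> a \<and> (\<forall>x s. 0 \<le> s \<longrightarrow>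
        (\<forall>u\<in>insert (\<lambda>_. 0) (first_forms w j). \<bar>u x\<bar> \<le> s) \<longrightarrow> \<bar>c i x\<bar> \<le> a * s ^ (N - i))"
      using c(1) form_bound by blast
    from choice[OF this] obtain a where a: "\<forall>i. i < N \<longrightarrow> 0 \<le> a i \<and> (\<forall>x s. 0 \<le> s \<longrightarrow>
        (\<forall>u\<in>insert (\<lambda>_. 0) (first_forms w j). \<bar>u x\<bar> \<le> s) \<longrightarrow> \<bar>c i x\<bar> \<le> a i * s ^ (N - i))" ..
    define C' where "C' = (1 + (\<Sum>i<N. a i)) * C"
    have "0 \<le> (\<Sum>i<N. a i)" using a by (intro sum_nonneg) auto
    then have C': "C \<le> C'" "0 \<le> C'"
      unfolding C'_def using C(1) by (auto simp: distrib_right)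
    have "\<bar>w j \<bullet> x\<bar> \<le> C' * s x" if x: "x \<in> S" for x
    proof -
      define T where "T = C * s x"
      have T: "0 \<le> T" unfolding T_def using C(1) s0 by auto
      have u: "\<forall>u\<in>insert (\<lambda>_. 0) (first_forms w j). \<bar>u x\<bar> \<le> T"
        using C(2) x T unfolding T_def first_forms_def by auto
      have "(w j \<bullet> x) ^ N = - (\<Sum>i<N. c i x * (w j \<bullet> x) ^ i)"
        using c(2) x by (simp add: eq_neg_iff_add_eq_0)
      then have "\<bar>w j \<bullet> x\<bar> ^ N = \<bar>\<Sum>i<N. c i x * (w j \<bullet> x) ^ i\<bar>"
        by (simp flip: power_abs)
      also have "\<dots> \<le> (\<Sum>i<N. \<bar>c i x * (w j \<bullet> x) ^ i\<bar>)" by (rule sum_abs)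
      also have "\<dots> \<le> (\<Sum>i<N. a i * T ^ (N - i) * \<bar>w j \<bullet> x\<bar> ^ i)"
      proof (rule sum_mono)
        fix i assume "i \<in> {..<N}"
        then have "\<bar>c i x\<bar> \<le> a i * T ^ (N - i)" using a T u by auto
        then show "\<bar>c i x * (w j \<bullet> x) ^ i\<bar> \<le> a i * T ^ (N - i) * \<bar>w j \<bullet> x\<bar> ^ i"
          unfolding abs_mult power_abs by (rule mult_right_mono) simp
      qed
      finally have "\<bar>w j \<bullet> x\<bar> \<le> (1 + (\<Sum>i<N. a i)) * T"
        by (intro root_bound) (use T a in auto)
      then show ?thesis unfolding T_def C'_def by (simp add: mult.assoc)
    qed
    moreover have "C * s x \<le> C' * s x" for x using C'(1) s0 by (rule mult_right_mono)
    ultimately have "\<forall>x\<in>S. \<forall>i<Suc j. \<bar>w i \<bullet> x\<bar> \<le> C' * s x"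
      using C(2) by (metis less_Suc_eq order_trans)
    then show ?case using C'(2) by blast
  qed
  from this[OF k order_refl] obtain C where C: "C \<ge> 0" "\<forall>x\<in>S. \<forall>i<DIM('a). \<bar>w i \<bullet> x\<bar> \<le> C * s x"
    by blast
  define B where "B = (\<Sum>i<DIM('a). norm (e i))"
  have "norm x \<le> (B * C) * s x" if x: "x \<in> S" for x
  proof -
    have "norm x = norm (\<Sum>i<DIM('a). (w i \<bullet> x) *\<^sub>R e i)"
      by (simp only: dual_bases_representation[OF dual])
    also have "\<dots> \<le> (\<Sum>i<DIM('a). norm ((w i \<bullet> x) *\<^sub>R e i))" by (rule norm_sum)
    also have "\<dots> \<le> (\<Sum>i<DIM('a). norm (e i) * (C * s x))"
    proof (rule sum_mono)
      fix i assume "i \<in> {..<DIM('a)}"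
      then have "\<bar>w i \<bullet> x\<bar> * norm (e i) \<le> (C * s x) * norm (e i)"
        using C(2) x by (intro mult_right_mono) auto
      then show "norm ((w i \<bullet> x) *\<^sub>R e i) \<le> norm (e i) * (C * s x)" by (simp add: mult.commute)
    qed
    also have "\<dots> = (B * C) * s x" unfolding B_def sum_distrib_right mult.assoc ..
    finally show ?thesis .
  qed
  moreover have "0 \<le> B * C" using C(1) unfolding B_def by (intro mult_nonneg_nonneg sum_nonneg) auto
  ultimately show ?thesis unfolding s_def by blast
qed

text \<open>
The forms are used as rows of a matrix, with zero rows added. A perturbation of norm less than r
  moves every row by less than r, which changes the estimate by at most half of the norm of x.
\<close>

lemma open_set_of_injective_matrices:
  fixes S :: "(real^'n) set" and w :: "nat \<Rightarrow> real^'n"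
  assumes k: "k \<le> CARD('s)" and C: "0 \<le> C" "\<And>x. x \<in> S \<Longrightarrow> norm x \<le> C * (\<Sum>i<k. \<bar>w i \<bullet> x\<bar>)"
  shows "\<exists>U :: (real^'n^'s) set. open U \<and> U \<noteq> {} \<and> (\<forall>M\<in>U. \<forall>x\<in>S. M *v x = 0 \<longrightarrow> x = 0)"
proof -
  obtain g where g: "bij_betw g (UNIV :: 's set) {0..<CARD('s)}"
    using ex_bij_betw_finite_nat[of "UNIV :: 's set"] by auto
  define M0 :: "real^'n^'s" where "M0 = (\<chi> \<sigma>. if g \<sigma> < k then w (g \<sigma>) else 0)"
  define B where "B = C * real CARD('s)"
  define r where "r = 1 / (2 * (B + 1))"
  have B: "0 \<le> B" unfolding B_def using C(1) by auto
  then have r: "0 < r" "B * r \<le> 1 / 2" unfolding r_def by (auto simp: field_simps)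
  have rows: "(\<Sum>i<k. \<bar>w i \<bullet> x\<bar>) \<le> (\<Sum>\<sigma>\<in>UNIV. \<bar>M0 $ \<sigma> \<bullet> x\<bar>)" for x
  proof -
    have "(\<Sum>\<sigma>\<in>UNIV. \<bar>M0 $ \<sigma> \<bullet> x\<bar>) = (\<Sum>\<sigma>\<in>UNIV. if g \<sigma> < k then \<bar>w (g \<sigma>) \<bullet> x\<bar> else 0)"
      by (rule sum.cong) (auto simp: M0_def)
    also have "\<dots> = (\<Sum>i\<in>{0..<CARD('s)}. if i < k then \<bar>w i \<bullet> x\<bar> else 0)"
      by (rule sum.reindex_bij_betw[OF g])
    also have "\<dots> = (\<Sum>i<k. \<bar>w i \<bullet> x\<bar>)"
      by (rule sum.mono_neutral_cong_right) (use k in auto)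
    finally show ?thesis by simp
  qed
  have "x = 0" if M: "M \<in> ball M0 r" "x \<in> S" "M *v x = 0" for M x
  proof -
    have "\<bar>M0 $ \<sigma> \<bullet> x\<bar> \<le> r * norm x" for \<sigma>
    proof -
      have "(M *v x) $ \<sigma> = M $ \<sigma> \<bullet> x" by (rule matrix_vector_mul_component)
      then have "M $ \<sigma> \<bullet> x = 0" using M(3) by simp
      then have "\<bar>M0 $ \<sigma> \<bullet> x\<bar> = \<bar>(M0 - M) $ \<sigma> \<bullet> x\<bar>" by (simp add: inner_diff_left)
      also have "\<dots> \<le> norm ((M0 - M) $ \<sigma>) * norm x" by (rule Cauchy_Schwarz_ineq2)
      also have "\<dots> \<le> r * norm x"
        using Finite_Cartesian_Product.norm_nth_le[of "M0 - M" \<sigma>] M(1) by (intro mult_right_mono) (auto simp: dist_norm)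
      finally show ?thesis .
    qed
    then have "(\<Sum>\<sigma>\<in>(UNIV :: 's set). \<bar>M0 $ \<sigma> \<bullet> x\<bar>) \<le> (\<Sum>\<sigma>\<in>(UNIV :: 's set). r * norm x)"
      by (intro sum_mono)
    then have "(\<Sum>i<k. \<bar>w i \<bullet> x\<bar>) \<le> real CARD('s) * (r * norm x)"
      using rows[of x] by simp
    then have "C * (\<Sum>i<k. \<bar>w i \<bullet> x\<bar>) \<le> C * (real CARD('s) * (r * norm x))"
      using C(1) by (rule mult_left_mono)
    with C(2)[OF M(2)] have "norm x \<le> C * (real CARD('s) * (r * norm x))" by (rule order_trans)
    also have "\<dots> = (B * r) * norm x" by (simp add: B_def)
    also have "\<dots> \<le> (1 / 2) * norm x" using r(2) by (rule mult_right_mono) simp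
    finally show "x = 0" by simp
  qed
  then show ?thesis using r(1) by (intro exI[of _ "ball M0 r"]) auto
qed

text \<open>
Homogeneous Noether normalization of the difference set ends with k forms that are independent
  on it and bound the norm there. The growth leaves room for at most d + 1 independent forms, so
  these forms fit into the rows of a matrix.
\<close>

lemma everywhere_identifiable_of_growth:
  fixes X :: "(real^'n) set"
  assumes growth: "\<And>m. spanned_by (difference_set X) (C * (m + 1) ^ d) {f. form (insert (\<lambda>_. 1) coord_forms) m f}"
    and s: "Suc d \<le> CARD('s)"
  shows "\<exists>U :: (real^'n^'s) set. open U \<and> U \<noteq> {} \<and> (\<forall>M\<in>U. everywhere_identifiable (\<lambda>x. M *v x) X)"
proof (cases "X = {}")
  case True
  then show ?thesis
    by (intro exI[of _ UNIV]) (auto simp: everywhere_identifiable_def)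
next
  case False
  then have "difference_set X \<noteq> {}" unfolding difference_set_def by blast
  from noether_normalization[OF this, of 0]
  obtain w e :: "nat \<Rightarrow> real^'n" and k where w: "k \<le> DIM(real^'n)" "dual_bases w e"
    "integral_from 0 w k (difference_set X)" "independent_on 0 w k (difference_set X)"
    by blast
  have "k \<le> Suc d" by (rule independent_forms_le_growth[OF w(2,1) growth w(4)])
  then have k: "k \<le> CARD('s)" using s by simp
  obtain B where B: "0 \<le> B" "\<forall>x\<in>difference_set X. norm x \<le> B * (\<Sum>i<k. \<bar>w i \<bullet> x\<bar>)"
    using norm_le_of_integral_from[OF w(2,1,3)] by blast
  from open_set_of_injective_matrices[OF k B(1), of "difference_set X" w] B(2)
  obtain U :: "(real^'n^'s) set" where U: "open U" "U \<noteq> {}"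
    "\<forall>M\<in>U. \<forall>x\<in>difference_set X. M *v x = 0 \<longrightarrow> x = 0"
    by blast
  have "everywhere_identifiable (\<lambda>x. M *v x) X" if "M \<in> U" for M
    unfolding everywhere_identifiable_def identifiable_at_def
  proof (intro ballI equalityI subsetI)
    fix x y assume "x \<in> X" "y \<in> {y \<in> X. M *v y = M *v x}"
    then have "y - x \<in> difference_set X" "M *v (y - x) = 0"
      unfolding difference_set_def by (auto simp: matrix_vector_mult_diff_distrib)
    then have "y - x = 0" using U(3) that by blast
    then show "y \<in> {x}" by simp
  qed auto
  then show ?thesis using U by blast
qed

section \<open>Identifiability of generic projections\<close>

lemma algebraic_zariski_closure: "algebraic_set (zariski_closure S)"
  unfolding zariski_closure_def
proof (rule hull_in)
  fix T :: "(real^'a) set set" assume "\<forall>V\<in>T. algebraic_set V"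
  then have "\<And>V. V \<in> T \<Longrightarrow> V = {x. \<forall>f\<in>vanishing_ideal V. f x = 0}"
    by (intro algebraic_eq_zeros_vanishing) blast
  then have "\<Inter>T = {x. \<forall>f\<in>(\<Union>V\<in>T. vanishing_ideal V). f x = 0}" by blast
  then show "algebraic_set (\<Inter>T)"
    unfolding algebraic_set_def
    by (intro exI[of _ "\<Union>V\<in>T. vanishing_ideal V"]) (auto simp: vanishing_ideal_def)
qed

lemma growth_le_model_dim:
  fixes S :: "(real^'n) set"
  assumes "S \<noteq> {}"
  shows "\<exists>d C. enat d \<le> model_dim S \<and>
    (\<forall>m. spanned_by S (C * (m + 1) ^ d) {f. form (insert (\<lambda>_. 1) coord_forms) m f})"
proof -
  have sub: "S \<subseteq> zariski_closure S" unfolding zariski_closure_def by (rule hull_subset)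
  then have "zariski_closure S \<noteq> {}" using assms by blast
  from growth_le_variety_dim[OF algebraic_zariski_closure this]
  obtain d C where d: "enat d \<le> model_dim S"
    and C: "\<forall>m. spanned_by (zariski_closure S) (C * (m + 1) ^ d) {f. form (insert (\<lambda>_. 1) coord_forms) m f}"
    unfolding model_dim_def by (elim exE conjE)
  have "spanned_by S (C * (m + 1) ^ d) {f. form (insert (\<lambda>_. 1) coord_forms) m f}" for m
    by (rule spanned_by_mono[OF spec[OF C, of m] order_refl subset_refl sub])
  with d have "enat d \<le> model_dim S \<and>
      (\<forall>m. spanned_by S (C * (m + 1) ^ d) {f. form (insert (\<lambda>_. 1) coord_forms) m f})" by simp
  then show ?thesis by - (rule exI, rule exI)
qed

theorem mainTheorem11:
  fixes X :: "(real^'n) set" and d :: enat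
  assumes "implicit_model X \<or> (\<exists>\<phi> :: real^'l \<Rightarrow> real^'n. explicit_model \<phi> X)"
    and "d = model_dim X"
  shows "(enat CARD('s) \<ge> 1 + model_dim (difference_set X) \<longrightarrow>
            (\<exists>U :: (real^'n^'s) set. open U \<and> U \<noteq> {} \<and>
               (\<forall>M\<in>U. everywhere_identifiable (\<lambda>x. M *v x) X))) \<and>
         (enat CARD('s) \<ge> 2 * d + 1 \<longrightarrow>
            (\<exists>U :: (real^'n^'s) set. open U \<and> U \<noteq> {} \<and>
               (\<forall>M\<in>U. everywhere_identifiable (\<lambda>x. M *v x) X)))"
proof (cases "X = {}")
  case True
  then have "open (UNIV :: (real^'n^'s) set) \<and> (UNIV :: (real^'n^'s) set) \<noteq> {} \<and>
      (\<forall>M\<in>(UNIV :: (real^'n^'s) set). everywhere_identifiable (\<lambda>x. M *v x) X)"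
    by (simp add: everywhere_identifiable_def)
  then have "\<exists>U :: (real^'n^'s) set. open U \<and> U \<noteq> {} \<and>
      (\<forall>M\<in>U. everywhere_identifiable (\<lambda>x. M *v x) X)" by (rule exI)
  then show ?thesis by (intro conjI impI)
next
  case False
  then have diff: "difference_set X \<noteq> {}" unfolding difference_set_def by blast
  show ?thesis
  proof (intro conjI impI)
    assume s: "enat CARD('s) \<ge> 1 + model_dim (difference_set X)"
    obtain r C where r: "enat r \<le> model_dim (difference_set X)"
      "\<forall>m. spanned_by (difference_set X) (C * (m + 1) ^ r) {f. form (insert (\<lambda>_. 1) coord_forms) m f}"
      using growth_le_model_dim[OF diff] by blast
    have "1 + enat r \<le> enat CARD('s)"
      using add_left_mono[OF r(1)] s by (rule order_trans)
    then have "Suc r \<le> CARD('s)" by (simp add: one_enat_def)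
    then show "\<exists>U :: (real^'n^'s) set. open U \<and> U \<noteq> {} \<and>
               (\<forall>M\<in>U. everywhere_identifiable (\<lambda>x. M *v x) X)"
      by (rule everywhere_identifiable_of_growth[rotated]) (use r(2) in blast)
  next
    assume s: "enat CARD('s) \<ge> 2 * d + 1"
    obtain r C where r: "enat r \<le> d"
      "\<forall>m. spanned_by X (C * (m + 1) ^ r) {f. form (insert (\<lambda>_. 1) coord_forms) m f}"
      using growth_le_model_dim[OF False] assms(2) by blast
    have "spanned_by (difference_set X) ((C * C) * (m + 1) ^ (2 * r)) {f. form (insert (\<lambda>_. 1) coord_forms) m f}" for m
    proof -
      have "(C * (m + 1) ^ r) * (C * (m + 1) ^ r) = (C * C) * (m + 1) ^ (2 * r)"
        unfolding mult_2 power_add by (simp only: mult_ac)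
      with spanned_by_difference_set[OF spec[OF r(2), of m]] show ?thesis by (simp only:)
    qed
    moreover have "2 * enat r + 1 \<le> enat CARD('s)"
      using add_right_mono[OF mult_left_mono[OF r(1)]] s by (rule order_trans) simp
    then have "Suc (2 * r) \<le> CARD('s)" by (simp add: one_enat_def numeral_eq_enat)
    ultimately show "\<exists>U :: (real^'n^'s) set. open U \<and> U \<noteq> {} \<and>
               (\<forall>M\<in>U. everywhere_identifiable (\<lambda>x. M *v x) X)"
      by (rule everywhere_identifiable_of_growth)
  qed
qed

end
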